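(* Assume the regularity assumption and the envelope assumption stated in the context hold at $P_e$. Let $(\bar\theta,\bar\eta,\bar\alpha)\in\Theta\times\Upsilon\times\Theta$ be in a neighborhood of $(\theta_{P_e},\eta_{P_e},\alpha_{P_e})$. Let $\delta_{\mathrm{lin}}:=\mathbf 1\{m_\theta\text{ is not linear in }\theta\text{ at }\theta_{P_e}\}$ and $\delta_{\mathrm{quad}}:=\mathbf 1\{\ell_{\theta,\eta_{P_e}}(\cdot)\text{ is not quadratic at }\theta_{P_e}\}$. Then \begin{align*} \Psi_e(\bar\theta)-\Psi_e(\theta_{P_e}) &=\mathbb E_{P_e}\left[\partial_\theta\ell_{\bar\theta,\bar\eta}(Z)[\bar\alpha]\right]-H_{P_e}(\bar\alpha-\alpha_{P_e},\,\bar\theta-\theta_{P_e})\\ &\quad+(\delta_{\mathrm{lin}}+\delta_{\mathrm{quad}})\,O\!\left(\|\bar\alpha\|_\Theta\,\|\bar\theta-\theta_{P_e}\|_\Theta^2\right)\\ &\quad+O\!\left(\|\bar\alpha\|_\Theta\left(\|\bar\theta-\theta_{P_e}\|_\Theta\|\bar\eta-\eta_{P_e}\|_\Upsilon+\|\bar\eta-\eta_{P_e}\|_\Upsilon^2\right)\right). \end{align*}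
   Context: $\mathcal Z=\mathcal C\times\mathcal A\times\mathbb R$ is the space of tuples $z=(c,a,y)$ (context, action, outcome) and $P_e$ is a fixed probability law of $Z$ on $\mathcal Z$ (the evaluation law: $C\sim P_C$, $A\mid C\sim\Pi_e(\cdot\mid C)$, $Y\mid C,A\sim P_Y(\cdot\mid C,A)$). $(\Theta,\|\cdot\|_\Theta)$ and $(\Upsilon,\|\cdot\|_\Upsilon)$ are normed linear spaces; $\ell_{\theta,\eta}(z)$ is a real-valued loss indexed by $(\theta,\eta)\in\Theta\times\Upsilon$; $\eta_{P_e}\in\Upsilon$ is a nuisance function; $\theta_{P_e}:=\arg\min_{\theta\in\Theta}\mathbb E_{P_e}[\ell_{\theta,\eta_{P_e}}(Z)]$; $m:\Theta\times\mathcal Z\to\mathbb R$, written $m_\theta(z)$, is measurable; $\Psi_e(\theta):=\mathbb E_{P_e}[m_\theta(Z)]$. Derivatives: $\partial_\theta f_{\theta,\eta}(z)[h]:=\frac{d}{d\epsilon}f_{\theta+\epsilon h,\eta}(z)|_{\epsilon=0}$, $\partial_\theta^2f_{\theta,\eta}(z)[h,u]:=\frac{\partial^2}{\partial\epsilon\,\partial\delta}f_{\theta+\epsilon h+\delta u,\eta}(z)|_{\epsilon=\delta=0}$ for $h,u\in\Theta$, and $\partial_\eta\partial_\theta f_{\theta,\eta}(z)[h,v]:=\frac{\partial^2}{\partial\delta\,\partial\epsilon}f_{\theta+\epsilon h,\eta+\delta v}(z)|_{\epsilon=\delta=0}$ for $h\in\Theta,v\in\Upsilon$. Regularity assumption: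 $\theta_{P_e}$ exists and is unique; (a) $\ell_{\theta,\eta}(z)$ is twice Fréchet differentiable in $\theta$ and $m_\theta(z)$ once Fréchet differentiable in $\theta$ in a neighborhood of $\theta_{P_e}$; (b) $\mathbb E_{P_e}[\partial_\theta\ell_{\theta_{P_e},\eta_{P_e}}(Z)[h]]=0$ for all $h\in\Theta$; (c) $\mathbb E_{P_e}[\partial_\eta\partial_\theta\ell_{\theta_{P_e},\eta_{P_e}}(Z)[h,u]]=0$ for all $h\in\Theta,u\in\Upsilon$; (d) with $H_{P_e}(u,h):=\mathbb E_{P_e}[\partial_\theta^2\ell_{\theta_{P_e},\eta_{P_e}}(Z)[h,u]]$, there is $c>0$ with $c\|h\|_\Theta^2\le H_{P_e}(h,h)$ for all $h\in\Theta$. Envelope assumption: there are $\epsilon_\Theta,\epsilon_\Upsilon>0$ and measurable $C:\mathcal Z\to\mathbb R_+$ with $\mathbb E_{P_e}[C(Z)^4]<\infty$ such that, whenever $\|\theta-\theta_{P_e}\|_\Theta,\|\theta'-\theta_{P_e}\|_\Theta\le\epsilon_\Theta$ and $\|\eta-\eta_{P_e}\|_\Upsilon,\|\eta'-\eta_{P_e}\|_\Upsilon\le\epsilon_\Upsilon$, for all $z$ and all $h,u\in\Theta$, $v\in\Upsilon$: $|m_\theta(z)|\le C(z)$; $|\partial_\theta m_\theta(z)[h]|\le C(z)\|h\|_\Theta$; $|\partial_\theta\ell_{\theta_{P_e},\eta_{P_e}}(z)[h]|\le C(z)\|h\|_\Theta$; $|\partial_\theta^2\ell_{\theta,\eta}(z)[h,u]|\le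 C(z)\|h\|_\Theta\|u\|_\Theta$; $|\partial_\eta\partial_\theta\ell_{\theta,\eta}(z)[h,v]|\le C(z)\|h\|_\Theta\|v\|_\Upsilon$; $|\partial_\theta m_\theta(z)[h]-\partial_\theta m_{\theta'}(z)[h]|\le C(z)\|\theta-\theta'\|_\Theta\|h\|_\Theta$; $|\partial_\eta\partial_\theta\ell_{\theta,\eta}(z)[h,v]-\partial_\eta\partial_\theta\ell_{\theta',\eta'}(z)[h,v]|\le C(z)(\|\theta-\theta'\|_\Theta+\|\eta-\eta'\|_\Upsilon)\|h\|_\Theta\|v\|_\Upsilon$; $|\partial_\theta^2\ell_{\theta,\eta}(z)[h,u]-\partial_\theta^2\ell_{\theta',\eta'}(z)[h,u]|\le C(z)(\|\theta-\theta'\|_\Theta+\|\eta-\eta'\|_\Upsilon)\|h\|_\Theta\|u\|_\Theta$. Riesz representer: $\bar\Theta$ is the completion of $\Theta$ in the norm $\|h\|_{H_{P_e}}:=H_{P_e}(h,h)^{1/2}$; $\|\cdot\|_\Theta$, $H_{P_e}$ and the derivative maps (in their $\Theta$-direction arguments) extend continuously to $\bar\Theta$. $\alpha_{P_e}\in\bar\Theta$ is the unique element with $\mathbb E_{P_e}[\partial_\theta m_{\theta_{P_e}}(Z)[h]]=H_{P_e}(\alpha_{P_e},h)$ for all $h\in\Theta$. The $O(\cdot)$ terms denote real quantities bounded in absolute value by a constant, not depending on $(\bar\theta,\bar\eta,\bar\alpha)$, times the displayed argument.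
   Formalization: The formal theorem additionally assumes that the Riesz representer α is nonzero whenever m is not linear at θ_{P_e}; without this the claim fails, e.g. for ℓ=θ²/2, m=θ², where α=0 and taking ᾱ=0 makes the right side vanish while the left side is θ̄². *)

theory Defs
  imports "HOL-Probability.Probability"
begin

definition eval_law ::
  "'c measure \<Rightarrow> 'd measure \<Rightarrow> 'c measure \<Rightarrow> ('c \<Rightarrow> 'd measure) \<Rightarrow> ('c \<times> 'd \<Rightarrow> real measure)
    \<Rightarrow> ('c \<times> 'd \<times> real) measure" where
  "eval_law MC MA PC Pi_e PY =
     bind PC (\<lambda>c. bind (Pi_e c) (\<lambda>a. bind (PY (c, a)) (\<lambda>y.
       return (MC \<Otimes>\<^sub>M MA \<Otimes>\<^sub>M borel) (c, a, y))))"

definition d_theta ::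
  "('a::real_normed_vector \<Rightarrow> 'z \<Rightarrow> real) \<Rightarrow> 'a \<Rightarrow> 'z \<Rightarrow> 'a \<Rightarrow> real" where
  "d_theta f \<theta> z h = deriv (\<lambda>\<epsilon>. f (\<theta> + \<epsilon> *\<^sub>R h) z) 0"

definition d2_theta ::
  "('a::real_normed_vector \<Rightarrow> 'z \<Rightarrow> real) \<Rightarrow> 'a \<Rightarrow> 'z \<Rightarrow> 'a \<Rightarrow> 'a \<Rightarrow> real" where
  "d2_theta f \<theta> z h u = deriv (\<lambda>\<epsilon>. deriv (\<lambda>\<delta>. f (\<theta> + \<epsilon> *\<^sub>R h + \<delta> *\<^sub>R u) z) 0) 0"

definition d_eta_theta ::
  "('a::real_normed_vector \<Rightarrow> 'b::real_normed_vector \<Rightarrow> 'z \<Rightarrow> real)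
    \<Rightarrow> 'a \<Rightarrow> 'b \<Rightarrow> 'z \<Rightarrow> 'a \<Rightarrow> 'b \<Rightarrow> real" where
  "d_eta_theta l \<theta> \<eta> z h v =
     deriv (\<lambda>\<delta>. deriv (\<lambda>\<epsilon>. l (\<theta> + \<epsilon> *\<^sub>R h) (\<eta> + \<delta> *\<^sub>R v) z) 0) 0"

definition twice_frechet_differentiable_on ::
  "('a::real_normed_vector \<Rightarrow> real) \<Rightarrow> 'a set \<Rightarrow> bool" where
  "twice_frechet_differentiable_on f S \<longleftrightarrow>
     (\<exists>D :: 'a \<Rightarrow> 'a \<Rightarrow>\<^sub>L real. \<forall>\<theta>\<in>S.
        (f has_derivative blinfun_apply (D \<theta>)) (at \<theta>) \<and> D differentiable (at \<theta>))"

(* The Bochner integral is 0 on non-integrable functions, so only parameters with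
   integrable loss compete. *)
definition is_unique_risk_minimizer ::
  "'z measure \<Rightarrow> ('a \<Rightarrow> 'b \<Rightarrow> 'z \<Rightarrow> real) \<Rightarrow> 'a \<Rightarrow> 'b \<Rightarrow> bool" where
  "is_unique_risk_minimizer P l \<theta>P \<eta>P \<longleftrightarrow>
     integrable P (l \<theta>P \<eta>P) \<and>
     (\<forall>\<theta>. \<theta> \<noteq> \<theta>P \<longrightarrow> integrable P (l \<theta> \<eta>P) \<longrightarrow> (\<integral>z. l \<theta>P \<eta>P z \<partial>P) < (\<integral>z. l \<theta> \<eta>P z \<partial>P))"

definition hess ::
  "'z measure \<Rightarrow> ('a::real_normed_vector \<Rightarrow> 'b \<Rightarrow> 'z \<Rightarrow> real) \<Rightarrow> 'a \<Rightarrow> 'b \<Rightarrow> 'a \<Rightarrow> 'a \<Rightarrow> real" where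
  "hess P l \<theta>P \<eta>P u h = (\<integral>z. d2_theta (\<lambda>\<theta>. l \<theta> \<eta>P) \<theta>P z h u \<partial>P)"

definition regularity ::
  "'z measure \<Rightarrow> ('a::real_normed_vector \<Rightarrow> 'b::real_normed_vector \<Rightarrow> 'z \<Rightarrow> real)
    \<Rightarrow> ('a \<Rightarrow> 'z \<Rightarrow> real) \<Rightarrow> 'a \<Rightarrow> 'b \<Rightarrow> bool" where
  "regularity P l m \<theta>P \<eta>P \<longleftrightarrow>
     is_unique_risk_minimizer P l \<theta>P \<eta>P \<and>
     (\<exists>r>0. \<forall>z\<in>space P.
        (\<forall>\<eta>\<in>ball \<eta>P r. twice_frechet_differentiable_on (\<lambda>\<theta>. l \<theta> \<eta> z) (ball \<theta>P r)) \<and>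
        (\<forall>\<theta>\<in>ball \<theta>P r. (\<lambda>\<theta>. m \<theta> z) differentiable (at \<theta>))) \<and>
     (\<forall>h. (\<integral>z. d_theta (\<lambda>\<theta>. l \<theta> \<eta>P) \<theta>P z h \<partial>P) = 0) \<and>
     (\<forall>h u. (\<integral>z. d_eta_theta l \<theta>P \<eta>P z h u \<partial>P) = 0) \<and>
     (\<exists>c>0. \<forall>h. c * (norm h)\<^sup>2 \<le> hess P l \<theta>P \<eta>P h h)"

(* The differentiability clause says that the mixed derivatives bounded below exist;
   deriv is total and would otherwise return an unspecified value. *)
definition envelope ::
  "'z measure \<Rightarrow> ('a::real_normed_vector \<Rightarrow> 'b::real_normed_vector \<Rightarrow> 'z \<Rightarrow> real)
    \<Rightarrow> ('a \<Rightarrow> 'z \<Rightarrow> real) \<Rightarrow> 'a \<Rightarrow> 'b \<Rightarrow> bool" where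
  "envelope P l m \<theta>P \<eta>P \<longleftrightarrow>
     (\<exists>r\<Theta>>0. \<exists>r\<Upsilon>>0. \<exists>C \<in> borel_measurable P.
        (\<forall>z\<in>space P. 0 \<le> C z) \<and> integrable P (\<lambda>z. C z ^ 4) \<and>
        (\<forall>\<theta>\<in>cball \<theta>P r\<Theta>. \<forall>\<theta>'\<in>cball \<theta>P r\<Theta>. \<forall>\<eta>\<in>cball \<eta>P r\<Upsilon>. \<forall>\<eta>'\<in>cball \<eta>P r\<Upsilon>.
         \<forall>z\<in>space P. \<forall>h u v.
           (\<lambda>\<delta>. d_theta (\<lambda>t. l t (\<eta> + \<delta> *\<^sub>R v)) \<theta> z h) differentiable (at (0::real)) \<and>
           \<bar>m \<theta> z\<bar> \<le> C z \<and>
           \<bar>d_theta m \<theta> z h\<bar> \<le> C z * norm h \<and>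
           \<bar>d_theta (\<lambda>t. l t \<eta>P) \<theta>P z h\<bar> \<le> C z * norm h \<and>
           \<bar>d2_theta (\<lambda>t. l t \<eta>) \<theta> z h u\<bar> \<le> C z * norm h * norm u \<and>
           \<bar>d_eta_theta l \<theta> \<eta> z h v\<bar> \<le> C z * norm h * norm v \<and>
           \<bar>d_theta m \<theta> z h - d_theta m \<theta>' z h\<bar> \<le> C z * norm (\<theta> - \<theta>') * norm h \<and>
           \<bar>d_eta_theta l \<theta> \<eta> z h v - d_eta_theta l \<theta>' \<eta>' z h v\<bar>
             \<le> C z * (norm (\<theta> - \<theta>') + norm (\<eta> - \<eta>')) * norm h * norm v \<and>
           \<bar>d2_theta (\<lambda>t. l t \<eta>) \<theta> z h u - d2_theta (\<lambda>t. l t \<eta>') \<theta>' z h u\<bar>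
             \<le> C z * (norm (\<theta> - \<theta>') + norm (\<eta> - \<eta>')) * norm h * norm u))"

(* The Banach type 'e, with the embedding j, is a completion of 'a for the norm N.
   Completions are unique up to isometry, so quantifying over all (j, 'e) loses nothing. *)
definition is_completion :: "('a::real_vector \<Rightarrow> real) \<Rightarrow> ('a \<Rightarrow> 'e::banach) \<Rightarrow> bool" where
  "is_completion N j \<longleftrightarrow> linear j \<and> (\<forall>h. norm (j h) = N h) \<and> closure (range j) = UNIV"

(* Extension by continuity of a form on 'a to the completion: the limit of B u h
   as j u tends to x and j h tends to y. *)
definition extend_form ::
  "('a \<Rightarrow> 'e::topological_space) \<Rightarrow> ('a \<Rightarrow> 'a \<Rightarrow> real) \<Rightarrow> 'e \<Rightarrow> 'e \<Rightarrow> real" where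
  "extend_form j B x y = Lim (filtercomap (map_prod j j) (nhds (x, y))) (\<lambda>(u, h). B u h)"

definition is_riesz_representer ::
  "'z measure \<Rightarrow> ('a::real_normed_vector \<Rightarrow> 'b \<Rightarrow> 'z \<Rightarrow> real) \<Rightarrow> ('a \<Rightarrow> 'z \<Rightarrow> real)
    \<Rightarrow> 'a \<Rightarrow> 'b \<Rightarrow> ('a \<Rightarrow> 'e::banach) \<Rightarrow> 'e \<Rightarrow> bool" where
  "is_riesz_representer P l m \<theta>P \<eta>P j \<alpha> \<longleftrightarrow>
     (\<forall>h. (\<integral>z. d_theta m \<theta>P z h \<partial>P) = extend_form j (hess P l \<theta>P \<eta>P) \<alpha> (j h))"

(* "Linear at" and "quadratic at" a point: agreement, on a neighbourhood that does not depend
   on z, with a polynomial in \<theta> of degree at most one resp. two. *)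
definition linear_at :: "'z set \<Rightarrow> ('a::real_normed_vector \<Rightarrow> 'z \<Rightarrow> real) \<Rightarrow> 'a \<Rightarrow> bool" where
  "linear_at S f \<theta>P \<longleftrightarrow>
     (\<exists>r>0. \<forall>z\<in>S. \<exists>L. linear L \<and> (\<forall>\<theta>\<in>ball \<theta>P r. f \<theta> z = f \<theta>P z + L (\<theta> - \<theta>P)))"

definition quadratic_at :: "'z set \<Rightarrow> ('a::real_normed_vector \<Rightarrow> 'z \<Rightarrow> real) \<Rightarrow> 'a \<Rightarrow> bool" where
  "quadratic_at S f \<theta>P \<longleftrightarrow>
     (\<exists>r>0. \<forall>z\<in>S. \<exists>L Q. linear L \<and> bilinear Q \<and>
        (\<forall>\<theta>\<in>ball \<theta>P r. f \<theta> z = f \<theta>P z + L (\<theta> - \<theta>P) + Q (\<theta> - \<theta>P) (\<theta> - \<theta>P)))"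

definition \<delta>_lin :: "'z measure \<Rightarrow> ('a::real_normed_vector \<Rightarrow> 'z \<Rightarrow> real) \<Rightarrow> 'a \<Rightarrow> real" where
  "\<delta>_lin P m \<theta>P = of_bool (\<not> linear_at (space P) m \<theta>P)"

definition \<delta>_quad ::
  "'z measure \<Rightarrow> ('a::real_normed_vector \<Rightarrow> 'b \<Rightarrow> 'z \<Rightarrow> real) \<Rightarrow> 'a \<Rightarrow> 'b \<Rightarrow> real" where
  "\<delta>_quad P l \<theta>P \<eta>P = of_bool (\<not> quadratic_at (space P) (\<lambda>\<theta>. l \<theta> \<eta>P) \<theta>P)"

definition \<Psi> :: "'z measure \<Rightarrow> ('a \<Rightarrow> 'z \<Rightarrow> real) \<Rightarrow> 'a \<Rightarrow> real" where
  "\<Psi> P m \<theta> = (\<integral>z. m \<theta> z \<partial>P)"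

end

theory Submission
  imports Defs
begin

text \<open>Writing \<open>h = \<theta> - \<theta>P\<close> and \<open>k = \<eta> - \<eta>P\<close>, expand pointwise in \<open>z\<close> with the mean value theorem and
  integrate against the envelope. The expansion of \<open>\<Psi>\<close> has leading term \<open>H(\<alpha>P, h)\<close> by the Riesz
  property, that of the score at \<open>\<eta>P\<close> has leading term \<open>H(\<alpha>, h)\<close>, and replacing \<open>\<eta>P\<close> by \<open>\<eta>\<close> in the
  score costs only second-order terms by Neyman orthogonality. The remainders of the first two
  expansions vanish identically in the linear and quadratic cases. Coercivity of \<open>H\<close> and the envelope
  bound on it make \<open>H\<close> bounded for the completed norm without an appeal to Cauchy-Schwarz.\<close>

section \<open>The evaluation law as a probability measure\<close>

lemma eval_law_in_prob_algebra:
  assumes PC: "PC \<in> space (prob_algebra MC)"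
    and Pi_e[measurable]: "Pi_e \<in> MC \<rightarrow>\<^sub>M prob_algebra MA"
    and PY[measurable]: "PY \<in> MC \<Otimes>\<^sub>M MA \<rightarrow>\<^sub>M prob_algebra borel"
  shows "eval_law MC MA PC Pi_e PY \<in> space (prob_algebra (MC \<Otimes>\<^sub>M MA \<Otimes>\<^sub>M borel))"
proof -
  let ?N = "MC \<Otimes>\<^sub>M MA \<Otimes>\<^sub>M (borel :: real measure)"
  have k: "(\<lambda>c. bind (Pi_e c) (\<lambda>a. bind (PY (c, a)) (\<lambda>y. return ?N (c, a, y))))
      \<in> MC \<rightarrow>\<^sub>M prob_algebra ?N"
    by measurable
  \<comment> \<open>\<open>PC\<close> is treated as a constant kernel on a one-point space, so the
    composition rule for kernels applies; evaluating at the point returns the law itself.\<close>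
  have "(\<lambda>_. bind PC (\<lambda>c. bind (Pi_e c) (\<lambda>a. bind (PY (c, a)) (\<lambda>y. return ?N (c, a, y)))))
      \<in> count_space (UNIV :: unit set) \<rightarrow>\<^sub>M prob_algebra ?N"
    by (rule measurable_bind_prob_space[OF _ k]) (use PC in simp)
  then show ?thesis
    unfolding eval_law_def by (auto dest: measurable_space)
qed

subsection \<open>Extension of bounded forms to the completion\<close>

text \<open>For fixed \<open>h\<close> the form is Lipschitz in its first argument with respect to
  \<open>norm (j u)\<close>, so it extends from the dense \<open>range j\<close> to a continuous
  \<open>E\<close>. The point is that the joint limit in \<open>extend_form\<close> then really
  exists at \<open>(x, j h)\<close>; \<open>Lim\<close> says nothing when a limit is
  missing.\<close>

lemma extend_form_continuous:
  fixes j :: "'a::real_vector \<Rightarrow> 'e::banach"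
  assumes j: "linear j" "closure (range j) = UNIV"
    and B: "bilinear B" "\<And>u h. \<bar>B u h\<bar> \<le> K * norm (j u) * norm (j h)"
  obtains E where "continuous_on UNIV E" "\<And>u. E (j u) = B u h"
    "\<And>x. extend_form j B x (j h) = E x"
proof -
  have lin: "linear (\<lambda>u. B u h)" "\<And>u. linear (B u)" for h
    using B(1) by (auto simp: bilinear_def)
  have j_diff: "j (u - v) = j u - j v" for u v
    using j(1) by (rule linear_diff)
  have lip: "\<bar>B u h - B v h\<bar> \<le> K * norm (j h) * dist (j u) (j v)" for u v
    using B(2)[of "u - v" h] by (simp add: linear_diff[OF lin(1)] j_diff dist_norm mult_ac)
  \<comment> \<open>\<open>j\<close> is not assumed injective. By \<open>lip\<close> all preimages
    of a point give the same value, so the choice is harmless.\<close>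
  define G where "G x = B (SOME u. j u = x) h" for x
  have G: "G (j u) = B u h" for u
  proof -
    have "j (SOME v. j v = j u) = j u" by (rule someI) simp
    then show ?thesis using lip[of "SOME v. j v = j u" u] by (simp add: G_def)
  qed
  \<comment> \<open>The assumptions do not fix the sign of \<open>K\<close>, while a Lipschitz
    constant must be nonnegative; hence the absolute value.\<close>
  have "\<bar>K * norm (j h)\<bar>-lipschitz_on (range j) G"
  proof (rule lipschitz_onI)
    fix x y assume "x \<in> range j" "y \<in> range j"
    then obtain u v where "x = j u" "y = j v" by blast
    then show "dist (G x) (G y) \<le> \<bar>K * norm (j h)\<bar> * dist x y"
      using lip[of u v] mult_right_mono[OF abs_ge_self[of "K * norm (j h)"], of "dist x y"]
      by (auto simp: G dist_real_def)
  qed simp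
  then have "uniformly_continuous_on (range j) G"
    by (rule lipschitz_on_uniformly_continuous)
  then obtain E where E: "uniformly_continuous_on (closure (range j)) E"
      "\<And>x. x \<in> range j \<Longrightarrow> G x = E x"
    by (rule uniformly_continuous_on_extension_on_closure) blast
  have cont: "continuous_on UNIV E"
    using E(1) j(2) by (auto dest: uniformly_continuous_imp_continuous)
  have Ej: "E (j u) = B u h" for u using E(2)[of "j u"] G by simp
  have "extend_form j B x (j h) = E x" for x
  proof -
    define F where "F = filtercomap (map_prod j j) (nhds (x, j h))"
    \<comment> \<open>Limits are unique only along a proper filter. Properness is density of
      \<open>range j\<close> near \<open>x\<close>; the second coordinate can stay at
      \<open>h\<close>.\<close>
    have "F \<noteq> bot"
      unfolding F_def
    proof (rule filtercomap_neq_bot)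
      fix P assume "eventually P (nhds (x, j h))"
      then obtain S where S: "open S" "(x, j h) \<in> S" "\<And>p. p \<in> S \<Longrightarrow> P p"
        by (auto simp: eventually_nhds)
      then obtain U V where UV: "open U" "open V" "x \<in> U" "j h \<in> V" "U \<times> V \<subseteq> S"
        by (auto elim!: open_prod_elim)
      then obtain u where "j u \<in> U"
        using j(2) open_Int_closure_eq_empty[of U "range j"] by fastforce
      then show "\<exists>p. P (map_prod j j p)" using UV S by (intro exI[of _ "(u, h)"]) auto
    qed
    have "(map_prod j j \<longlongrightarrow> (x, j h)) F"
      unfolding F_def by (rule filterlim_filtercomap)
    from tendsto_fst[OF this] tendsto_snd[OF this]
    have 1: "((\<lambda>p. j (fst p)) \<longlongrightarrow> x) F" and 2: "((\<lambda>p. j (snd p)) \<longlongrightarrow> j h) F"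
      by (simp_all add: map_prod_def case_prod_unfold)
    have 3: "((\<lambda>p. E (j (fst p))) \<longlongrightarrow> E x) F"
      by (rule isCont_tendsto_compose[OF _ 1])
        (use cont in \<open>simp add: continuous_on_eq_continuous_at\<close>)
    have "((\<lambda>p. K * norm (j (fst p)) * norm (j (snd p) - j h)) \<longlongrightarrow>
        K * norm x * norm (j h - j h)) F"
      by (intro tendsto_intros 1 2)
    then have lim: "((\<lambda>p. K * norm (j (fst p)) * norm (j (snd p) - j h)) \<longlongrightarrow> 0) F"
      by simp
    \<comment> \<open>Along \<open>F\<close> the second argument varies as well. Bilinearity turns
      its effect into \<open>B (fst p) (snd p - h)\<close>, bounded by a convergent factor times one
      tending to zero.\<close>
    have "norm (B (fst p) (snd p) - E (j (fst p))) \<le> K * norm (j (fst p)) * norm (j (snd p) - j h)" for p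
      using B(2)[of "fst p" "snd p - h"] by (simp add: linear_diff[OF lin(2)] j_diff Ej)
    from Lim_null_comparison[OF always_eventually[OF allI, OF this] lim]
    have "((\<lambda>p. B (fst p) (snd p) - E (j (fst p))) \<longlongrightarrow> 0) F" .
    from tendsto_add[OF this 3] have "((\<lambda>p. B (fst p) (snd p)) \<longlongrightarrow> E x) F" by simp
    then show ?thesis
      using tendsto_Lim[OF \<open>F \<noteq> bot\<close>] by (simp add: extend_form_def F_def case_prod_unfold)
  qed
  with cont Ej that show ?thesis by blast
qed

text \<open>Linearity in the first slot holds on \<open>range j\<close> and passes to the completion
  by density: \<open>E (j a - x) + E x\<close> is continuous in \<open>x\<close> and constant on the
  range. This later separates the Hessian at \<alpha> from the Riesz pairing with \<alpha>P.\<close>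

lemma extend_form_diff:
  fixes j :: "'a::real_vector \<Rightarrow> 'e::banach"
  assumes j: "linear j" "closure (range j) = UNIV"
    and B: "bilinear B" "\<And>u h. \<bar>B u h\<bar> \<le> K * norm (j u) * norm (j h)"
  shows "extend_form j B (j a - x) (j h) = B a h - extend_form j B x (j h)"
proof -
  obtain E where E: "continuous_on UNIV E" "\<And>u. E (j u) = B u h"
      "\<And>x. extend_form j B x (j h) = E x"
    using extend_form_continuous[OF assms] by blast
  have "E (j a - x) + E x = B a h"
  proof (rule continuous_constant_on_closure[of "range j"])
    show "continuous_on (closure (range j)) (\<lambda>x. E (j a - x) + E x)"
      unfolding j(2) by (intro continuous_intros continuous_on_compose2[OF E(1)]) auto
    show "E (j a - x) + E x = B a h" if x: "x \<in> range j" for x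
    proof -
      from x obtain u where u: "x = j u" by blast
      have "E (j a - x) = B (a - u) h"
        unfolding u using E(2)[of "a - u"] by (simp add: linear_diff[OF j(1)])
      moreover have "B (a - u) h = B a h - B u h"
        using B(1) by (simp add: bilinear_lsub)
      ultimately show ?thesis by (simp add: u E(2))
    qed
  qed (simp add: j(2))
  then show ?thesis by (simp add: E(3))
qed

subsection \<open>Directional derivatives\<close>

lemma has_real_derivative_along_line:
  fixes f :: "'a::real_normed_vector \<Rightarrow> real"
  assumes "(f has_derivative D) (at x)"
  shows "((\<lambda>\<epsilon>. f (x + \<epsilon> *\<^sub>R h)) has_real_derivative D h) (at 0)"
proof -
  have "((\<lambda>\<epsilon>. f (x + \<epsilon> *\<^sub>R h)) has_derivative (\<lambda>\<epsilon>. D (\<epsilon> *\<^sub>R h))) (at 0)"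
    by (rule has_derivative_compose[where g=f])
      (use assms in \<open>auto intro!: derivative_eq_intros\<close>)
  moreover have "D (\<epsilon> *\<^sub>R h) = D h * \<epsilon>" for \<epsilon>
    using linear_cmul[OF has_derivative_linear[OF assms]] by simp
  ultimately show ?thesis by (simp add: has_field_derivative_def)
qed

lemma d_theta_eq:
  assumes "((\<lambda>\<theta>. f \<theta> z) has_derivative D) (at \<theta>)"
  shows "d_theta f \<theta> z h = D h"
  unfolding d_theta_def by (rule DERIV_imp_deriv[OF has_real_derivative_along_line[OF assms]])

lemma eventually_line_in_open:
  fixes x :: "'a::real_normed_vector"
  assumes "open S" "x \<in> S"
  shows "\<forall>\<^sub>F \<epsilon> in nhds (0::real). x + \<epsilon> *\<^sub>R h \<in> S"
proof -
  have "((\<lambda>\<epsilon>. x + \<epsilon> *\<^sub>R h) \<longlongrightarrow> x + 0 *\<^sub>R h) (nhds (0::real))"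
    by (intro tendsto_intros) (simp add: filterlim_ident)
  then show ?thesis using topological_tendstoD assms by fastforce
qed

text \<open>\<open>deriv\<close> is total, so \<open>d_theta\<close> and \<open>d2_theta\<close>
  carry information only once actual derivatives are exhibited. Restricting the Frechet derivatives
  to lines supplies them. Bilinearity is inherited: the outer derivative is linear in
  \<open>h\<close>, and its values are linear in \<open>u\<close>.\<close>

lemma twice_frechet_differentiable_onD:
  assumes f: "twice_frechet_differentiable_on (\<lambda>\<theta>. f \<theta> z) S" and S: "open S" "\<theta> \<in> S"
  shows "((\<lambda>\<epsilon>. f (\<theta> + \<epsilon> *\<^sub>R h) z) has_real_derivative d_theta f \<theta> z h) (at 0)"
    and "((\<lambda>\<epsilon>. d_theta f (\<theta> + \<epsilon> *\<^sub>R h) z u) has_real_derivative d2_theta f \<theta> z h u) (at 0)"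
    and "bilinear (d2_theta f \<theta> z)"
proof -
  from f obtain D where D: "\<And>\<theta>. \<theta> \<in> S \<Longrightarrow> ((\<lambda>\<theta>. f \<theta> z) has_derivative blinfun_apply (D \<theta>)) (at \<theta>)"
      "\<And>\<theta>. \<theta> \<in> S \<Longrightarrow> D differentiable (at \<theta>)"
    unfolding twice_frechet_differentiable_on_def by blast
  then obtain D' where D': "(D has_derivative D') (at \<theta>)"
    using S(2) unfolding differentiable_def by blast
  have eq: "d_theta f t z v = blinfun_apply (D t) v" if "t \<in> S" for t v
    using D(1)[OF that] by (rule d_theta_eq)
  show "((\<lambda>\<epsilon>. f (\<theta> + \<epsilon> *\<^sub>R h) z) has_real_derivative d_theta f \<theta> z h) (at 0)"
    unfolding eq[OF S(2)] by (rule has_real_derivative_along_line[OF D(1)[OF S(2)]])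
  have der: "((\<lambda>\<epsilon>. d_theta f (\<theta> + \<epsilon> *\<^sub>R h) z u) has_real_derivative D' h u) (at 0)" for h u
  proof -
    have "((\<lambda>t. blinfun_apply (D t) u) has_derivative (\<lambda>h. blinfun_apply (D' h) u)) (at \<theta>)"
      using D' by (auto intro!: derivative_eq_intros)
    from has_real_derivative_along_line[OF this, of h]
    have der: "((\<lambda>\<epsilon>. blinfun_apply (D (\<theta> + \<epsilon> *\<^sub>R h)) u) has_real_derivative D' h u) (at 0)" .
    \<comment> \<open>\<open>eq\<close> holds only inside the open set \<open>S\<close>, but a
      derivative at 0 sees just the small \<epsilon>.\<close>
    have ev: "\<forall>\<^sub>F \<epsilon> in nhds 0. blinfun_apply (D (\<theta> + \<epsilon> *\<^sub>R h)) u = d_theta f (\<theta> + \<epsilon> *\<^sub>R h) z u"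
      using eventually_line_in_open[OF S, of h] by eventually_elim (simp add: eq)
    show ?thesis
      using DERIV_cong_ev[OF refl ev refl, THEN iffD1, OF der] .
  qed
  have d2: "d2_theta f \<theta> z h u = D' h u" for h u
    using DERIV_imp_deriv[OF der[of h u]] by (simp add: d2_theta_def d_theta_def)
  show "((\<lambda>\<epsilon>. d_theta f (\<theta> + \<epsilon> *\<^sub>R h) z u) has_real_derivative d2_theta f \<theta> z h u) (at 0)"
    unfolding d2 by (rule der)
  interpret D': linear D' using D' by (rule has_derivative_linear)
  show "bilinear (d2_theta f \<theta> z)"
    by (auto simp: bilinear_def d2 linear_iff blinfun.add_left blinfun.add_right blinfun.scaleR_left
      blinfun.scaleR_right D'.add D'.scaleR)
qed

text \<open>The derivative is the pointwise limit of measurable difference quotients along one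
  sequence of increments. Measurability is asked only near 0 because first derivatives, to which the
  lemma is applied again, are known to be measurable only inside the balls.\<close>

lemma borel_measurable_derivative:
  fixes g :: "real \<Rightarrow> 'z \<Rightarrow> real"
  assumes meas: "\<forall>\<^sub>F \<epsilon> in nhds 0. g \<epsilon> \<in> borel_measurable M"
    and der: "\<And>z. z \<in> space M \<Longrightarrow> ((\<lambda>\<epsilon>. g \<epsilon> z) has_real_derivative g' z) (at 0)"
  shows "g' \<in> borel_measurable M"
proof -
  from meas obtain d where d: "d > 0" "\<And>\<epsilon>. \<bar>\<epsilon>\<bar> < d \<Longrightarrow> g \<epsilon> \<in> borel_measurable M"
    by (auto simp: eventually_nhds_metric dist_real_def)
  \<comment> \<open>The offset 2 keeps even \<open>e 0 = d / 2\<close> strictly below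
    \<open>d\<close>; every increment is also nonzero, as the quotients require.\<close>
  define e where "e n = d / (real n + 2)" for n
  have e: "e n \<noteq> 0" "\<bar>e n\<bar> < d" for n
    using d(1) by (auto simp: e_def field_simps add_pos_nonneg)
  have lim: "e \<longlonglongrightarrow> 0"
    unfolding e_def by real_asymp
  have [measurable]: "g (e n) \<in> borel_measurable M" "g 0 \<in> borel_measurable M" for n
    using d e by auto
  show ?thesis
  proof (rule borel_measurable_LIMSEQ_real)
    fix z assume "z \<in> space M"
    from der[OF this] have "((\<lambda>x. (g x z - g 0 z) / x) \<longlongrightarrow> g' z) (at 0)"
      by (simp add: DERIV_def)
    moreover have "filterlim e (at 0) sequentially"
      using lim e by (simp add: filterlim_at)
    ultimately show "(\<lambda>n. (g (e n) z - g 0 z) / e n) \<longlonglongrightarrow> g' z"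
      by (rule filterlim_compose)
  qed measurable
qed

text \<open>By the mean value theorem the remainder equals \<open>f' x - c\<close> at one interior
  point, so a uniform bound on that difference suffices. The derivative is taken at 0 of a shifted
  function to match the form of \<open>d_theta\<close> and its relatives.\<close>

lemma mean_value_bound:
  fixes f f' :: "real \<Rightarrow> real"
  assumes der: "\<And>x. 0 \<le> x \<Longrightarrow> x \<le> 1 \<Longrightarrow> ((\<lambda>\<epsilon>. f (x + \<epsilon>)) has_real_derivative f' x) (at 0)"
    and bd: "\<And>x. 0 \<le> x \<Longrightarrow> x \<le> 1 \<Longrightarrow> \<bar>f' x - c\<bar> \<le> B"
  shows "\<bar>f 1 - f 0 - c\<bar> \<le> B"
proof -
  have "(f has_real_derivative f' x) (at x)" if "0 \<le> x" "x \<le> 1" for x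
    using der[OF that] DERIV_shift[of f "f' x" 0 x] by (simp add: add.commute)
  from MVT2[of 0 1 f f', OF _ this] obtain x where "0 < x" "x < 1" "f 1 - f 0 = f' x" by auto
  with bd[of x] show ?thesis by simp
qed

subsection \<open>Remainder bounds\<close>

lemma segment_in_ball:
  fixes h :: "'a::real_normed_vector"
  assumes "x + h \<in> ball x r" "0 \<le> s" "s \<le> (1::real)"
  shows "x + s *\<^sub>R h \<in> ball x r"
proof -
  have "norm (s *\<^sub>R h) \<le> norm h" using assms(2,3) by (simp add: mult_left_le_one_le)
  with assms(1) show ?thesis by (simp add: dist_norm)
qed

text \<open>The regularity and envelope assumptions, with a common radius for all neighbourhoods.\<close>

locale enveloped_loss = prob_space P for P :: "'z measure" +
  fixes l :: "'a::real_normed_vector \<Rightarrow> 'b::real_normed_vector \<Rightarrow> 'z \<Rightarrow> real"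
    and m :: "'a \<Rightarrow> 'z \<Rightarrow> real" and \<theta>P :: 'a and \<eta>P :: 'b and C :: "'z \<Rightarrow> real" and r :: real
  assumes r: "0 < r"
    and l_meas [measurable]: "\<And>\<theta> \<eta>. l \<theta> \<eta> \<in> borel_measurable P"
    and m_meas [measurable]: "\<And>\<theta>. m \<theta> \<in> borel_measurable P"
    and C_nonneg: "\<And>z. z \<in> space P \<Longrightarrow> 0 \<le> C z"
    and C_int: "integrable P C"
    and l_diff: "\<And>z \<eta>. z \<in> space P \<Longrightarrow> \<eta> \<in> ball \<eta>P r \<Longrightarrow>
      twice_frechet_differentiable_on (\<lambda>\<theta>. l \<theta> \<eta> z) (ball \<theta>P r)"
    and m_diff: "\<And>z \<theta>. z \<in> space P \<Longrightarrow> \<theta> \<in> ball \<theta>P r \<Longrightarrow> (\<lambda>\<theta>. m \<theta> z) differentiable (at \<theta>)"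
    and score_mean: "\<And>h. (\<integral>z. d_theta (\<lambda>\<theta>. l \<theta> \<eta>P) \<theta>P z h \<partial>P) = 0"
    and cross_mean: "\<And>h v. (\<integral>z. d_eta_theta l \<theta>P \<eta>P z h v \<partial>P) = 0"
    and cross_diff: "\<And>z \<theta> \<eta> h v. z \<in> space P \<Longrightarrow> \<theta> \<in> ball \<theta>P r \<Longrightarrow> \<eta> \<in> ball \<eta>P r \<Longrightarrow>
      (\<lambda>\<delta>. d_theta (\<lambda>t. l t (\<eta> + \<delta> *\<^sub>R v)) \<theta> z h) differentiable (at (0::real))"
    and m_bound: "\<And>z \<theta>. z \<in> space P \<Longrightarrow> \<theta> \<in> ball \<theta>P r \<Longrightarrow> \<bar>m \<theta> z\<bar> \<le> C z"
    and dm_bound: "\<And>z h. z \<in> space P \<Longrightarrow> \<bar>d_theta m \<theta>P z h\<bar> \<le> C z * norm h"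
    and dm_lip: "\<And>z \<theta> h. z \<in> space P \<Longrightarrow> \<theta> \<in> ball \<theta>P r \<Longrightarrow>
      \<bar>d_theta m \<theta> z h - d_theta m \<theta>P z h\<bar> \<le> C z * norm (\<theta> - \<theta>P) * norm h"
    and score_bound: "\<And>z h. z \<in> space P \<Longrightarrow> \<bar>d_theta (\<lambda>t. l t \<eta>P) \<theta>P z h\<bar> \<le> C z * norm h"
    and hess_bound: "\<And>z h u. z \<in> space P \<Longrightarrow>
      \<bar>d2_theta (\<lambda>t. l t \<eta>P) \<theta>P z h u\<bar> \<le> C z * norm h * norm u"
    and hess_lip: "\<And>z \<theta> h u. z \<in> space P \<Longrightarrow> \<theta> \<in> ball \<theta>P r \<Longrightarrow>
      \<bar>d2_theta (\<lambda>t. l t \<eta>P) \<theta> z h u - d2_theta (\<lambda>t. l t \<eta>P) \<theta>P z h u\<bar>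
        \<le> C z * norm (\<theta> - \<theta>P) * norm h * norm u"
    and cross_bound: "\<And>z h v. z \<in> space P \<Longrightarrow>
      \<bar>d_eta_theta l \<theta>P \<eta>P z h v\<bar> \<le> C z * norm h * norm v"
    and cross_lip: "\<And>z \<theta> \<eta> h v. z \<in> space P \<Longrightarrow> \<theta> \<in> ball \<theta>P r \<Longrightarrow> \<eta> \<in> ball \<eta>P r \<Longrightarrow>
      \<bar>d_eta_theta l \<theta> \<eta> z h v - d_eta_theta l \<theta>P \<eta>P z h v\<bar>
        \<le> C z * (norm (\<theta> - \<theta>P) + norm (\<eta> - \<eta>P)) * norm h * norm v"
begin

abbreviation "H \<equiv> hess P l \<theta>P \<eta>P"

section \<open>Integration against the envelope\<close>

definition M :: real where "M = (\<integral>z. C z \<partial>P)"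

lemma M_nonneg: "0 \<le> M"
  unfolding M_def using C_nonneg by (intro integral_nonneg_AE AE_I2)

lemma centre: "\<theta>P \<in> ball \<theta>P r" "\<eta>P \<in> ball \<eta>P r"
  using r by auto

text \<open>Every remainder below is bounded pointwise by \<open>C z * K\<close> and then integrated
  here. Taking \<open>K = 0\<close> turns an estimate into an exact identity, which is how the
  linear and quadratic cases are treated.\<close>

lemma dominated:
  assumes "f \<in> borel_measurable P" "\<And>z. z \<in> space P \<Longrightarrow> \<bar>f z\<bar> \<le> C z * K"
  shows "integrable P f" "\<bar>\<integral>z. f z \<partial>P\<bar> \<le> M * K"
proof -
  have CK: "integrable P (\<lambda>z. C z * K)" using C_int by simp
  show int: "integrable P f"
    by (rule Bochner_Integration.integrable_bound[OF CK assms(1)])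
      (use assms(2) in \<open>auto intro!: order_trans[OF _ abs_ge_self]\<close>)
  have "\<bar>\<integral>z. f z \<partial>P\<bar> \<le> (\<integral>z. \<bar>f z\<bar> \<partial>P)"
    by (rule integral_abs_bound)
  also have "\<dots> \<le> (\<integral>z. C z * K \<partial>P)"
    by (intro integral_mono integrable_abs int CK assms(2))
  finally show "\<bar>\<integral>z. f z \<partial>P\<bar> \<le> M * K" by (simp add: M_def)
qed

lemma l_derivs:
  assumes "z \<in> space P" "\<theta> \<in> ball \<theta>P r" "\<eta> \<in> ball \<eta>P r"
  shows "((\<lambda>\<epsilon>. l (\<theta> + \<epsilon> *\<^sub>R h) \<eta> z) has_real_derivative d_theta (\<lambda>t. l t \<eta>) \<theta> z h) (at 0)"
    and "((\<lambda>\<epsilon>. d_theta (\<lambda>t. l t \<eta>) (\<theta> + \<epsilon> *\<^sub>R h) z u)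
      has_real_derivative d2_theta (\<lambda>t. l t \<eta>) \<theta> z h u) (at 0)"
    and "bilinear (d2_theta (\<lambda>t. l t \<eta>) \<theta> z)"
proof -
  note D = twice_frechet_differentiable_onD[of "\<lambda>t. l t \<eta>", OF l_diff[OF assms(1,3)] open_ball assms(2)]
  show "((\<lambda>\<epsilon>. l (\<theta> + \<epsilon> *\<^sub>R h) \<eta> z) has_real_derivative d_theta (\<lambda>t. l t \<eta>) \<theta> z h) (at 0)"
    by (rule D(1))
  show "((\<lambda>\<epsilon>. d_theta (\<lambda>t. l t \<eta>) (\<theta> + \<epsilon> *\<^sub>R h) z u)
      has_real_derivative d2_theta (\<lambda>t. l t \<eta>) \<theta> z h u) (at 0)"
    by (rule D(2))
  show "bilinear (d2_theta (\<lambda>t. l t \<eta>) \<theta> z)"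
    by (rule D(3))
qed

lemma m_deriv:
  assumes "z \<in> space P" "\<theta> \<in> ball \<theta>P r"
  shows "((\<lambda>\<epsilon>. m (\<theta> + \<epsilon> *\<^sub>R h) z) has_real_derivative d_theta m \<theta> z h) (at 0)"
proof -
  obtain D where D: "((\<lambda>\<theta>. m \<theta> z) has_derivative D) (at \<theta>)"
    using m_diff[OF assms] by (auto simp: differentiable_def)
  show ?thesis
    unfolding d_theta_eq[of m z, OF D] by (rule has_real_derivative_along_line[OF D])
qed

lemma cross_deriv:
  assumes "z \<in> space P" "\<theta> \<in> ball \<theta>P r" "\<eta> \<in> ball \<eta>P r"
  shows "((\<lambda>\<delta>. d_theta (\<lambda>t. l t (\<eta> + \<delta> *\<^sub>R v)) \<theta> z h)
    has_real_derivative d_eta_theta l \<theta> \<eta> z h v) (at 0)"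
  using cross_diff[OF assms, of v h] unfolding d_eta_theta_def d_theta_def
  by (simp add: DERIV_deriv_iff_real_differentiable)

section \<open>Measurability of the derivatives and the Hessian form\<close>

lemma measurable_d_theta [measurable]:
  assumes "\<theta> \<in> ball \<theta>P r" "\<eta> \<in> ball \<eta>P r"
  shows "(\<lambda>z. d_theta (\<lambda>t. l t \<eta>) \<theta> z h) \<in> borel_measurable P"
  by (rule borel_measurable_derivative[OF _ l_derivs(1)]) (use assms in auto)

lemma measurable_d_theta_m [measurable]:
  "(\<lambda>z. d_theta m \<theta>P z h) \<in> borel_measurable P"
  by (rule borel_measurable_derivative[OF _ m_deriv]) (use centre in auto)

lemma measurable_d2_theta [measurable]:
  "(\<lambda>z. d2_theta (\<lambda>t. l t \<eta>P) \<theta>P z h u) \<in> borel_measurable P"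
  by (rule borel_measurable_derivative[OF _ l_derivs(2)])
    (use centre in \<open>auto intro: eventually_mono[OF eventually_line_in_open[of "ball \<theta>P r" \<theta>P h]]
      measurable_d_theta\<close>)

lemma measurable_d_eta_theta [measurable]:
  "(\<lambda>z. d_eta_theta l \<theta>P \<eta>P z h v) \<in> borel_measurable P"
  by (rule borel_measurable_derivative[OF _ cross_deriv])
    (use centre in \<open>auto intro: eventually_mono[OF eventually_line_in_open[of "ball \<eta>P r" \<eta>P v]]
      measurable_d_theta\<close>)

lemma hess_integrable: "integrable P (\<lambda>z. d2_theta (\<lambda>t. l t \<eta>P) \<theta>P z h u)"
  by (rule dominated[where K="norm h * norm u"]) (use hess_bound in \<open>auto simp: mult.assoc\<close>)

lemma hess_le: "\<bar>H u h\<bar> \<le> M * norm u * norm h"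
proof -
  have "\<bar>d2_theta (\<lambda>t. l t \<eta>P) \<theta>P z h u\<bar> \<le> C z * (norm u * norm h)" if "z \<in> space P" for z
    using hess_bound[OF that, of h u] by (simp add: mult_ac)
  from dominated(2)[OF measurable_d2_theta this] show ?thesis
    by (simp add: hess_def mult.assoc)
qed

lemma bilinear_hess: "bilinear H"
proof -
  let ?q = "\<lambda>z. d2_theta (\<lambda>t. l t \<eta>P) \<theta>P z"
  have bil: "bilinear (?q z)" if "z \<in> space P" for z
    using l_derivs(3)[OF that centre] .
  \<comment> \<open>The arguments are swapped: \<open>H u h\<close> integrates
    \<open>?q z h u\<close>, so additivity in the second argument of \<open>H\<close> comes from the
    first direction of \<open>?q\<close>.\<close>
  have "H u (h + h') = H u h + H u h'" for u h h'
  proof -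
    have "H u (h + h') = (\<integral>z. ?q z h u + ?q z h' u \<partial>P)"
      unfolding hess_def by (rule Bochner_Integration.integral_cong) (simp_all add: bilinear_ladd[OF bil])
    then show ?thesis by (simp add: hess_def hess_integrable)
  qed
  moreover have "H (u + u') h = H u h + H u' h" for u u' h
  proof -
    have "H (u + u') h = (\<integral>z. ?q z h u + ?q z h u' \<partial>P)"
      unfolding hess_def by (rule Bochner_Integration.integral_cong) (simp_all add: bilinear_radd[OF bil])
    then show ?thesis by (simp add: hess_def hess_integrable)
  qed
  moreover have "H u (c *\<^sub>R h) = c * H u h" for c u h
  proof -
    have "H u (c *\<^sub>R h) = (\<integral>z. c * ?q z h u \<partial>P)"
      unfolding hess_def by (rule Bochner_Integration.integral_cong) (simp_all add: bilinear_lmul[OF bil])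
    then show ?thesis by (simp add: hess_def)
  qed
  moreover have "H (c *\<^sub>R u) h = c * H u h" for c u h
  proof -
    have "H (c *\<^sub>R u) h = (\<integral>z. c * ?q z h u \<partial>P)"
      unfolding hess_def by (rule Bochner_Integration.integral_cong) (simp_all add: bilinear_rmul[OF bil])
    then show ?thesis by (simp add: hess_def)
  qed
  ultimately show ?thesis by (auto simp: bilinear_def intro!: linearI)
qed

section \<open>Expansion of \<Psi> at \<theta>P\<close>

lemma \<Psi>_dominated:
  assumes "\<theta> \<in> ball \<theta>P r"
    and "\<And>z. z \<in> space P \<Longrightarrow> \<bar>m \<theta> z - m \<theta>P z - d_theta m \<theta>P z (\<theta> - \<theta>P)\<bar> \<le> C z * K"
  shows "\<bar>\<Psi> P m \<theta> - \<Psi> P m \<theta>P - (\<integral>z. d_theta m \<theta>P z (\<theta> - \<theta>P) \<partial>P)\<bar> \<le> M * K"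
proof -
  have m_int: "integrable P (m t)" if "t \<in> ball \<theta>P r" for t
    by (rule dominated(1)[where K=1]) (use m_bound that in auto)
  have dm_int: "integrable P (\<lambda>z. d_theta m \<theta>P z (\<theta> - \<theta>P))"
    by (rule dominated(1)[OF _ dm_bound]) auto
  have "\<Psi> P m \<theta> - \<Psi> P m \<theta>P - (\<integral>z. d_theta m \<theta>P z (\<theta> - \<theta>P) \<partial>P)
      = (\<integral>z. m \<theta> z - m \<theta>P z - d_theta m \<theta>P z (\<theta> - \<theta>P) \<partial>P)"
    using m_int assms(1) centre(1) dm_int by (simp add: \<Psi>_def)
  with dominated(2)[OF _ assms(2)] show ?thesis by simp
qed

text \<open>On the segment from \<theta>P to \<theta> the Lipschitz envelope bounds the change of
  \<open>d_theta m\<close> in direction \<open>\<theta> - \<theta>P\<close> by \<open>C z\<close>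
  times the squared norm; the mean value theorem makes this the pointwise remainder.\<close>

lemma \<Psi>_remainder:
  assumes "\<theta> \<in> ball \<theta>P r"
  shows "\<bar>\<Psi> P m \<theta> - \<Psi> P m \<theta>P - (\<integral>z. d_theta m \<theta>P z (\<theta> - \<theta>P) \<partial>P)\<bar> \<le> M * (norm (\<theta> - \<theta>P))\<^sup>2"
proof (rule \<Psi>_dominated[OF assms])
  fix z assume z: "z \<in> space P"
  let ?h = "\<theta> - \<theta>P"
  have "\<bar>m (\<theta>P + 1 *\<^sub>R ?h) z - m (\<theta>P + 0 *\<^sub>R ?h) z - d_theta m \<theta>P z ?h\<bar> \<le> C z * (norm ?h)\<^sup>2"
  proof (rule mean_value_bound[of "\<lambda>s. m (\<theta>P + s *\<^sub>R ?h) z" "\<lambda>s. d_theta m (\<theta>P + s *\<^sub>R ?h) z ?h"])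
    fix s :: real assume s: "0 \<le> s" "s \<le> 1"
    then have ball: "\<theta>P + s *\<^sub>R ?h \<in> ball \<theta>P r" using assms by (intro segment_in_ball) auto
    show "((\<lambda>\<epsilon>. m (\<theta>P + (s + \<epsilon>) *\<^sub>R ?h) z) has_real_derivative d_theta m (\<theta>P + s *\<^sub>R ?h) z ?h) (at 0)"
      using m_deriv[OF z ball, of ?h] by (simp add: scaleR_add_left add.assoc)
    have "C z * (s * norm ?h) * norm ?h \<le> C z * (1 * norm ?h) * norm ?h"
      using s C_nonneg[OF z] by (intro mult_right_mono mult_left_mono) auto
    then show "\<bar>d_theta m (\<theta>P + s *\<^sub>R ?h) z ?h - d_theta m \<theta>P z ?h\<bar> \<le> C z * (norm ?h)\<^sup>2"
      using dm_lip[OF z ball, of ?h] s by (simp add: power2_eq_square mult.assoc)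
  qed
  then show "\<bar>m \<theta> z - m \<theta>P z - d_theta m \<theta>P z ?h\<bar> \<le> C z * (norm ?h)\<^sup>2" by simp
qed

text \<open>Near \<theta>P the map is affine along lines with slope
  \<open>L (\<theta> - \<theta>P)\<close>, so this slope is the directional derivative and the
  pointwise remainder is zero. The radius is common to all \<open>z\<close>, which permits
  integration.\<close>

lemma \<Psi>_linear:
  assumes "linear_at (space P) m \<theta>P"
  obtains s where "s > 0" "\<And>\<theta>. \<theta> \<in> ball \<theta>P s \<Longrightarrow>
    \<Psi> P m \<theta> - \<Psi> P m \<theta>P = (\<integral>z. d_theta m \<theta>P z (\<theta> - \<theta>P) \<partial>P)"
proof -
  from assms obtain s where s: "s > 0" "\<And>z. z \<in> space P \<Longrightarrow>
      \<exists>L. linear L \<and> (\<forall>\<theta>\<in>ball \<theta>P s. m \<theta> z = m \<theta>P z + L (\<theta> - \<theta>P))"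
    unfolding linear_at_def by blast
  show ?thesis
  proof (rule that[of "min s r"])
    fix \<theta> assume "\<theta> \<in> ball \<theta>P (min s r)"
    then have \<theta>: "\<theta> \<in> ball \<theta>P s" "\<theta> \<in> ball \<theta>P r" by auto
    let ?h = "\<theta> - \<theta>P"
    have "\<bar>m \<theta> z - m \<theta>P z - d_theta m \<theta>P z ?h\<bar> \<le> C z * 0" if z: "z \<in> space P" for z
    proof -
      from s(2)[OF z] obtain L where L: "linear L"
        "\<And>\<theta>. \<theta> \<in> ball \<theta>P s \<Longrightarrow> m \<theta> z = m \<theta>P z + L (\<theta> - \<theta>P)" by blast
      have ev: "\<forall>\<^sub>F \<epsilon> in nhds 0. m (\<theta>P + \<epsilon> *\<^sub>R ?h) z = m \<theta>P z + \<epsilon> * L ?h"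
        using eventually_line_in_open[OF open_ball centre_in_ball[THEN iffD2, OF s(1)], of \<theta>P ?h]
        by eventually_elim (simp add: L(2) linear_cmul[OF L(1)])
      have "((\<lambda>\<epsilon>. m \<theta>P z + \<epsilon> * L ?h) has_real_derivative L ?h) (at 0)"
        by (auto intro!: derivative_eq_intros)
      from DERIV_cong_ev[OF refl ev refl, THEN iffD2, OF this]
      have "d_theta m \<theta>P z ?h = L ?h"
        unfolding d_theta_def by (rule DERIV_imp_deriv)
      then show ?thesis using L(2)[OF \<theta>(1)] by simp
    qed
    from \<Psi>_dominated[OF \<theta>(2) this]
    show "\<Psi> P m \<theta> - \<Psi> P m \<theta>P = (\<integral>z. d_theta m \<theta>P z ?h \<partial>P)" by simp
  qed (use s r in auto)
qed

section \<open>Expansion of the score\<close>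

lemma score_dominated:
  assumes "\<theta> \<in> ball \<theta>P r"
    and "\<And>z. z \<in> space P \<Longrightarrow> \<bar>d_theta (\<lambda>t. l t \<eta>P) \<theta> z \<alpha> - d_theta (\<lambda>t. l t \<eta>P) \<theta>P z \<alpha>
      - d2_theta (\<lambda>t. l t \<eta>P) \<theta>P z (\<theta> - \<theta>P) \<alpha>\<bar> \<le> C z * K"
  shows "integrable P (\<lambda>z. d_theta (\<lambda>t. l t \<eta>P) \<theta> z \<alpha>)"
    and "\<bar>(\<integral>z. d_theta (\<lambda>t. l t \<eta>P) \<theta> z \<alpha> \<partial>P) - H \<alpha> (\<theta> - \<theta>P)\<bar> \<le> M * K"
proof -
  let ?d = "\<lambda>t z. d_theta (\<lambda>t. l t \<eta>P) t z \<alpha>" and ?q = "\<lambda>z. d2_theta (\<lambda>t. l t \<eta>P) \<theta>P z (\<theta> - \<theta>P) \<alpha>"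
  have [measurable]: "?d \<theta> \<in> borel_measurable P" "?d \<theta>P \<in> borel_measurable P"
    using assms(1) centre measurable_d_theta by auto
  have d0: "integrable P (?d \<theta>P)"
    by (rule dominated(1)[OF _ score_bound]) measurable
  have rem: "integrable P (\<lambda>z. ?d \<theta> z - ?d \<theta>P z - ?q z)" "\<bar>\<integral>z. ?d \<theta> z - ?d \<theta>P z - ?q z \<partial>P\<bar> \<le> M * K"
    by (rule dominated[OF _ assms(2)]; measurable)+
  \<comment> \<open>Integrability of the score at \<theta> is derived: integrable terms are added
    back to the dominated remainder.\<close>
  have "integrable P (\<lambda>z. (?d \<theta> z - ?d \<theta>P z - ?q z) + (?d \<theta>P z + ?q z))"
    by (intro Bochner_Integration.integrable_add rem(1) d0 hess_integrable)
  then show int: "integrable P (?d \<theta>)" by simp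
  \<comment> \<open>The first-order condition \<open>score_mean\<close> removes the term at
    \<theta>P, and the second-order term integrates to
    \<open>H \<alpha> (\<theta> - \<theta>P)\<close>.\<close>
  have "(\<integral>z. ?d \<theta> z - ?d \<theta>P z - ?q z \<partial>P) = (\<integral>z. ?d \<theta> z \<partial>P) - H \<alpha> (\<theta> - \<theta>P)"
    using int d0 hess_integrable by (simp add: score_mean hess_def)
  with rem(2) show "\<bar>(\<integral>z. ?d \<theta> z \<partial>P) - H \<alpha> (\<theta> - \<theta>P)\<bar> \<le> M * K" by simp
qed

text \<open>The function followed along the segment is already a first derivative in direction
  \<alpha>, so its own derivative is \<open>d2_theta\<close>, whose drift \<open>hess_lip\<close>
  controls. The direction \<alpha> contributes the factor \<open>norm \<alpha>\<close>.\<close>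

lemma score_remainder:
  assumes "\<theta> \<in> ball \<theta>P r"
  shows "integrable P (\<lambda>z. d_theta (\<lambda>t. l t \<eta>P) \<theta> z \<alpha>)"
    and "\<bar>(\<integral>z. d_theta (\<lambda>t. l t \<eta>P) \<theta> z \<alpha> \<partial>P) - H \<alpha> (\<theta> - \<theta>P)\<bar>
      \<le> M * (norm \<alpha> * (norm (\<theta> - \<theta>P))\<^sup>2)"
proof -
  let ?h = "\<theta> - \<theta>P"
  have "\<bar>d_theta (\<lambda>t. l t \<eta>P) \<theta> z \<alpha> - d_theta (\<lambda>t. l t \<eta>P) \<theta>P z \<alpha>
      - d2_theta (\<lambda>t. l t \<eta>P) \<theta>P z ?h \<alpha>\<bar> \<le> C z * (norm \<alpha> * (norm ?h)\<^sup>2)" if z: "z \<in> space P" for z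
  proof -
    have "\<bar>d_theta (\<lambda>t. l t \<eta>P) (\<theta>P + 1 *\<^sub>R ?h) z \<alpha> - d_theta (\<lambda>t. l t \<eta>P) (\<theta>P + 0 *\<^sub>R ?h) z \<alpha>
        - d2_theta (\<lambda>t. l t \<eta>P) \<theta>P z ?h \<alpha>\<bar> \<le> C z * (norm \<alpha> * (norm ?h)\<^sup>2)"
    proof (rule mean_value_bound[of "\<lambda>s. d_theta (\<lambda>t. l t \<eta>P) (\<theta>P + s *\<^sub>R ?h) z \<alpha>"
          "\<lambda>s. d2_theta (\<lambda>t. l t \<eta>P) (\<theta>P + s *\<^sub>R ?h) z ?h \<alpha>"])
      fix s :: real assume s: "0 \<le> s" "s \<le> 1"
      then have ball: "\<theta>P + s *\<^sub>R ?h \<in> ball \<theta>P r" using assms by (intro segment_in_ball) auto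
      show "((\<lambda>\<epsilon>. d_theta (\<lambda>t. l t \<eta>P) (\<theta>P + (s + \<epsilon>) *\<^sub>R ?h) z \<alpha>)
          has_real_derivative d2_theta (\<lambda>t. l t \<eta>P) (\<theta>P + s *\<^sub>R ?h) z ?h \<alpha>) (at 0)"
        using l_derivs(2)[OF z ball centre(2), of ?h \<alpha>] by (simp add: scaleR_add_left add.assoc)
      have "C z * (s * norm ?h) * norm ?h * norm \<alpha> \<le> C z * (1 * norm ?h) * norm ?h * norm \<alpha>"
        using s C_nonneg[OF z] by (intro mult_right_mono mult_left_mono) auto
      then show "\<bar>d2_theta (\<lambda>t. l t \<eta>P) (\<theta>P + s *\<^sub>R ?h) z ?h \<alpha> - d2_theta (\<lambda>t. l t \<eta>P) \<theta>P z ?h \<alpha>\<bar>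
          \<le> C z * (norm \<alpha> * (norm ?h)\<^sup>2)"
        using hess_lip[OF z ball, of ?h \<alpha>] s by (simp add: power2_eq_square mult_ac)
    qed
    then show ?thesis by simp
  qed
  from score_dominated[OF assms this]
  show "integrable P (\<lambda>z. d_theta (\<lambda>t. l t \<eta>P) \<theta> z \<alpha>)"
    and "\<bar>(\<integral>z. d_theta (\<lambda>t. l t \<eta>P) \<theta> z \<alpha> \<partial>P) - H \<alpha> (\<theta> - \<theta>P)\<bar>
      \<le> M * (norm \<alpha> * (norm (\<theta> - \<theta>P))\<^sup>2)" by auto
qed

text \<open>The derivative of a quadratic function is affine in \<theta>, so its first-order
  expansion at \<theta>P has no remainder.\<close>

lemma score_quadratic:
  assumes "quadratic_at (space P) (\<lambda>\<theta>. l \<theta> \<eta>P) \<theta>P"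
  obtains s where "s > 0" "\<And>\<theta> \<alpha>. \<theta> \<in> ball \<theta>P s \<Longrightarrow>
    (\<integral>z. d_theta (\<lambda>t. l t \<eta>P) \<theta> z \<alpha> \<partial>P) = H \<alpha> (\<theta> - \<theta>P)"
proof -
  from assms obtain s where s: "s > 0" "\<And>z. z \<in> space P \<Longrightarrow> \<exists>L Q. linear L \<and> bilinear Q \<and>
      (\<forall>\<theta>\<in>ball \<theta>P s. l \<theta> \<eta>P z = l \<theta>P \<eta>P z + L (\<theta> - \<theta>P) + Q (\<theta> - \<theta>P) (\<theta> - \<theta>P))"
    unfolding quadratic_at_def by blast
  show ?thesis
  proof (rule that[of "min s r"])
    fix \<theta> \<alpha> assume "\<theta> \<in> ball \<theta>P (min s r)"
    then have \<theta>: "\<theta> \<in> ball \<theta>P s" "\<theta> \<in> ball \<theta>P r" by auto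
    let ?h = "\<theta> - \<theta>P"
    have "\<bar>d_theta (\<lambda>t. l t \<eta>P) \<theta> z \<alpha> - d_theta (\<lambda>t. l t \<eta>P) \<theta>P z \<alpha>
      - d2_theta (\<lambda>t. l t \<eta>P) \<theta>P z ?h \<alpha>\<bar> \<le> C z * 0" if z: "z \<in> space P" for z
    proof -
      from s(2)[OF z] obtain L Q where L: "linear L" and Q: "bilinear Q"
        and eq: "\<And>\<theta>. \<theta> \<in> ball \<theta>P s \<Longrightarrow> l \<theta> \<eta>P z = l \<theta>P \<eta>P z + L (\<theta> - \<theta>P) + Q (\<theta> - \<theta>P) (\<theta> - \<theta>P)"
        by blast
      note Q_simps = bilinear_ladd[OF Q] bilinear_radd[OF Q] bilinear_lmul[OF Q] bilinear_rmul[OF Q]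
      \<comment> \<open>\<open>Q\<close> is not assumed symmetric, hence the two \<open>Q\<close>
        terms. The formula is stated around \<theta>P and not just at it, since it is differentiated
        once more below.\<close>
      have d: "d_theta (\<lambda>t. l t \<eta>P) t z \<alpha> = L \<alpha> + Q (t - \<theta>P) \<alpha> + Q \<alpha> (t - \<theta>P)"
        if t: "t \<in> ball \<theta>P s" for t
      proof -
        have ev: "\<forall>\<^sub>F \<epsilon> in nhds 0. l (t + \<epsilon> *\<^sub>R \<alpha>) \<eta>P z = l t \<eta>P z
            + \<epsilon> * (L \<alpha> + Q (t - \<theta>P) \<alpha> + Q \<alpha> (t - \<theta>P)) + \<epsilon>\<^sup>2 * Q \<alpha> \<alpha>"
          using eventually_line_in_open[OF open_ball t, of \<alpha>]
        proof eventually_elim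
          case (elim \<epsilon>)
          have "t + \<epsilon> *\<^sub>R \<alpha> - \<theta>P = (t - \<theta>P) + \<epsilon> *\<^sub>R \<alpha>" by simp
          then show ?case
            using eq[OF elim] eq[OF t]
            by (simp only: Q_simps linear_add[OF L] linear_cmul[OF L])
              (simp add: algebra_simps power2_eq_square)
        qed
        have "((\<lambda>\<epsilon>. l t \<eta>P z + \<epsilon> * (L \<alpha> + Q (t - \<theta>P) \<alpha> + Q \<alpha> (t - \<theta>P)) + \<epsilon>\<^sup>2 * Q \<alpha> \<alpha>)
            has_real_derivative L \<alpha> + Q (t - \<theta>P) \<alpha> + Q \<alpha> (t - \<theta>P)) (at 0)"
          by (auto intro!: derivative_eq_intros)
        from DERIV_cong_ev[OF refl ev refl, THEN iffD2, OF this]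
        show ?thesis unfolding d_theta_def by (rule DERIV_imp_deriv)
      qed
      have ev: "\<forall>\<^sub>F \<epsilon> in nhds 0. d_theta (\<lambda>t. l t \<eta>P) (\<theta>P + \<epsilon> *\<^sub>R ?h) z \<alpha>
          = L \<alpha> + \<epsilon> * (Q ?h \<alpha> + Q \<alpha> ?h)"
        using eventually_line_in_open[OF open_ball centre_in_ball[THEN iffD2, OF s(1)], of \<theta>P ?h]
        by eventually_elim (simp add: d bilinear_lmul[OF Q] bilinear_rmul[OF Q] distrib_left)
      have "((\<lambda>\<epsilon>. L \<alpha> + \<epsilon> * (Q ?h \<alpha> + Q \<alpha> ?h)) has_real_derivative Q ?h \<alpha> + Q \<alpha> ?h) (at 0)"
        by (auto intro!: derivative_eq_intros)
      from DERIV_cong_ev[OF refl ev refl, THEN iffD2, OF this]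
      have "d2_theta (\<lambda>t. l t \<eta>P) \<theta>P z ?h \<alpha> = Q ?h \<alpha> + Q \<alpha> ?h"
        using l_derivs(2)[OF z centre, of ?h \<alpha>] by (metis DERIV_unique)
      then show ?thesis
        using d[OF \<theta>(1)] d[of \<theta>P] s(1) by (simp add: bilinear_lzero[OF Q] bilinear_rzero[OF Q])
    qed
    from score_dominated(2)[OF \<theta>(2) this]
    show "(\<integral>z. d_theta (\<lambda>t. l t \<eta>P) \<theta> z \<alpha> \<partial>P) = H \<alpha> ?h" by simp
  qed (use s r in auto)
qed

text \<open>Neyman orthogonality removes the term linear in \<open>\<eta> - \<eta>P\<close>.\<close>

lemma nuisance_remainder:
  assumes "\<theta> \<in> ball \<theta>P r" "\<eta> \<in> ball \<eta>P r"
  shows "\<bar>(\<integral>z. d_theta (\<lambda>t. l t \<eta>) \<theta> z \<alpha> \<partial>P) - (\<integral>z. d_theta (\<lambda>t. l t \<eta>P) \<theta> z \<alpha> \<partial>P)\<bar>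
    \<le> M * (norm \<alpha> * (norm (\<theta> - \<theta>P) * norm (\<eta> - \<eta>P) + (norm (\<eta> - \<eta>P))\<^sup>2))"
proof -
  let ?k = "\<eta> - \<eta>P"
  let ?d = "\<lambda>\<eta> z. d_theta (\<lambda>t. l t \<eta>) \<theta> z \<alpha>" and ?q = "\<lambda>z. d_eta_theta l \<theta>P \<eta>P z \<alpha> ?k"
  let ?K = "norm \<alpha> * (norm (\<theta> - \<theta>P) * norm ?k + (norm ?k)\<^sup>2)"
  have [measurable]: "?d \<eta> \<in> borel_measurable P" "?d \<eta>P \<in> borel_measurable P"
    using assms centre measurable_d_theta by auto
  \<comment> \<open>The subtracted term sits at (\<theta>P, \<eta>P), where
    \<open>cross_mean\<close> makes it integrate to zero. Moving both arguments there costs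
    \<open>norm (\<theta> - \<theta>P) + norm ?k\<close> in \<open>cross_lip\<close>, the origin of
    the two second-order terms.\<close>
  have bound: "\<bar>?d \<eta> z - ?d \<eta>P z - ?q z\<bar> \<le> C z * ?K" if z: "z \<in> space P" for z
  proof -
    have "\<bar>?d (\<eta>P + 1 *\<^sub>R ?k) z - ?d (\<eta>P + 0 *\<^sub>R ?k) z - ?q z\<bar> \<le> C z * ?K"
    proof (rule mean_value_bound[of "\<lambda>s. ?d (\<eta>P + s *\<^sub>R ?k) z"
          "\<lambda>s. d_eta_theta l \<theta> (\<eta>P + s *\<^sub>R ?k) z \<alpha> ?k"])
      fix s :: real assume s: "0 \<le> s" "s \<le> 1"
      then have ball: "\<eta>P + s *\<^sub>R ?k \<in> ball \<eta>P r" using assms by (intro segment_in_ball) auto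
      show "((\<lambda>\<epsilon>. ?d (\<eta>P + (s + \<epsilon>) *\<^sub>R ?k) z)
          has_real_derivative d_eta_theta l \<theta> (\<eta>P + s *\<^sub>R ?k) z \<alpha> ?k) (at 0)"
        using cross_deriv[OF z assms(1) ball, of ?k \<alpha>] by (simp add: scaleR_add_left add.assoc)
      have "C z * (norm (\<theta> - \<theta>P) + s * norm ?k) * norm \<alpha> * norm ?k
          \<le> C z * (norm (\<theta> - \<theta>P) + 1 * norm ?k) * norm \<alpha> * norm ?k"
        using s C_nonneg[OF z] by (intro mult_right_mono mult_left_mono add_left_mono) auto
      also have "\<dots> = C z * ?K" by (simp only: power2_eq_square) algebra
      finally show "\<bar>d_eta_theta l \<theta> (\<eta>P + s *\<^sub>R ?k) z \<alpha> ?k - ?q z\<bar> \<le> C z * ?K"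
        using cross_lip[OF z assms(1) ball, of \<alpha> ?k] s by simp
    qed
    then show ?thesis by simp
  qed
  have rem: "integrable P (\<lambda>z. ?d \<eta> z - ?d \<eta>P z - ?q z)" "\<bar>\<integral>z. ?d \<eta> z - ?d \<eta>P z - ?q z \<partial>P\<bar> \<le> M * ?K"
    by (rule dominated[OF _ bound]; measurable)+
  have q: "integrable P ?q"
    by (rule dominated(1)[where K="norm \<alpha> * norm ?k"]) (use cross_bound in \<open>auto simp: mult.assoc\<close>)
  have d0: "integrable P (?d \<eta>P)" by (rule score_remainder(1)[OF assms(1)])
  have "integrable P (\<lambda>z. (?d \<eta> z - ?d \<eta>P z - ?q z) + (?d \<eta>P z + ?q z))"
    by (intro Bochner_Integration.integrable_add rem(1) d0 q)
  then have "integrable P (?d \<eta>)" by simp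
  then have "(\<integral>z. ?d \<eta> z - ?d \<eta>P z - ?q z \<partial>P) = (\<integral>z. ?d \<eta> z \<partial>P) - (\<integral>z. ?d \<eta>P z \<partial>P)"
    using d0 q by (simp add: cross_mean)
  with rem(2) show ?thesis by simp
qed

end

section \<open>Reduction of the assumptions to one common radius\<close>

lemma enveloped_lossI:
  assumes P: "prob_space P"
    and l_meas: "\<And>\<theta> \<eta>. l \<theta> \<eta> \<in> borel_measurable P"
    and m_meas: "\<And>\<theta>. m \<theta> \<in> borel_measurable P"
    and reg: "regularity P l m \<theta>P \<eta>P" and env: "envelope P l m \<theta>P \<eta>P"
  obtains C r where "enveloped_loss P l m \<theta>P \<eta>P C r"
proof -
  interpret prob_space P by (rule P)
  from reg obtain r0 where r0: "r0 > 0"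
      "\<And>z \<eta>. z \<in> space P \<Longrightarrow> \<eta> \<in> ball \<eta>P r0 \<Longrightarrow>
        twice_frechet_differentiable_on (\<lambda>\<theta>. l \<theta> \<eta> z) (ball \<theta>P r0)"
      "\<And>z \<theta>. z \<in> space P \<Longrightarrow> \<theta> \<in> ball \<theta>P r0 \<Longrightarrow> (\<lambda>\<theta>. m \<theta> z) differentiable (at \<theta>)"
    unfolding regularity_def by blast
  from env obtain rT rU C where rT: "rT > 0" and rU: "rU > 0" and C: "C \<in> borel_measurable P"
      "\<And>z. z \<in> space P \<Longrightarrow> 0 \<le> C z" "integrable P (\<lambda>z. C z ^ 4)"
    and bds: "\<forall>\<theta>\<in>cball \<theta>P rT. \<forall>\<theta>'\<in>cball \<theta>P rT. \<forall>\<eta>\<in>cball \<eta>P rU. \<forall>\<eta>'\<in>cball \<eta>P rU.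
         \<forall>z\<in>space P. \<forall>h u v.
           (\<lambda>\<delta>. d_theta (\<lambda>t. l t (\<eta> + \<delta> *\<^sub>R v)) \<theta> z h) differentiable (at (0::real)) \<and>
           \<bar>m \<theta> z\<bar> \<le> C z \<and>
           \<bar>d_theta m \<theta> z h\<bar> \<le> C z * norm h \<and>
           \<bar>d_theta (\<lambda>t. l t \<eta>P) \<theta>P z h\<bar> \<le> C z * norm h \<and>
           \<bar>d2_theta (\<lambda>t. l t \<eta>) \<theta> z h u\<bar> \<le> C z * norm h * norm u \<and>
           \<bar>d_eta_theta l \<theta> \<eta> z h v\<bar> \<le> C z * norm h * norm v \<and>
           \<bar>d_theta m \<theta> z h - d_theta m \<theta>' z h\<bar> \<le> C z * norm (\<theta> - \<theta>') * norm h \<and>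
           \<bar>d_eta_theta l \<theta> \<eta> z h v - d_eta_theta l \<theta>' \<eta>' z h v\<bar>
             \<le> C z * (norm (\<theta> - \<theta>') + norm (\<eta> - \<eta>')) * norm h * norm v \<and>
           \<bar>d2_theta (\<lambda>t. l t \<eta>) \<theta> z h u - d2_theta (\<lambda>t. l t \<eta>') \<theta>' z h u\<bar>
             \<le> C z * (norm (\<theta> - \<theta>') + norm (\<eta> - \<eta>')) * norm h * norm u"
    unfolding envelope_def by (elim exE conjE bexE) blast
  define r where "r = min r0 (min rT rU)"
  have r: "0 < r" using r0(1) rT rU by (simp add: r_def)
  have mem: "\<theta> \<in> cball \<theta>P rT" if "\<theta> \<in> ball \<theta>P r" for \<theta> using that by (simp add: r_def)
  have mem': "\<eta> \<in> cball \<eta>P rU" if "\<eta> \<in> ball \<eta>P r" for \<eta> using that by (simp add: r_def)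
  have centre: "\<theta>P \<in> ball \<theta>P r" "\<eta>P \<in> ball \<eta>P r" using r by auto
  \<comment> \<open>The envelope is controlled through its fourth moment. \<open>C z\<close> is at
    most 1 or at most its fourth power, and constants are integrable under a probability
    law.\<close>
  have C_le: "C z \<le> 1 + C z ^ 4" if "z \<in> space P" for z
    using C(2)[OF that] self_le_power[of "C z" 4] by (cases "1 \<le> C z") (auto simp: add_increasing2)
  have C_int: "integrable P C"
    by (rule Bochner_Integration.integrable_bound[of _ "\<lambda>z. 1 + C z ^ 4"])
      (use C C_le in auto)
  \<comment> \<open>The second pair of parameters in the envelope bounds is fixed at the centre, the
    comparison point of all remainders.\<close>
  have bds': "(\<lambda>\<delta>. d_theta (\<lambda>t. l t (\<eta> + \<delta> *\<^sub>R v)) \<theta> z h) differentiable (at (0::real)) \<and>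
           \<bar>m \<theta> z\<bar> \<le> C z \<and>
           \<bar>d_theta m \<theta> z h\<bar> \<le> C z * norm h \<and>
           \<bar>d_theta (\<lambda>t. l t \<eta>P) \<theta>P z h\<bar> \<le> C z * norm h \<and>
           \<bar>d2_theta (\<lambda>t. l t \<eta>) \<theta> z h u\<bar> \<le> C z * norm h * norm u \<and>
           \<bar>d_eta_theta l \<theta> \<eta> z h v\<bar> \<le> C z * norm h * norm v \<and>
           \<bar>d_theta m \<theta> z h - d_theta m \<theta>P z h\<bar> \<le> C z * norm (\<theta> - \<theta>P) * norm h \<and>
           \<bar>d_eta_theta l \<theta> \<eta> z h v - d_eta_theta l \<theta>P \<eta>P z h v\<bar>
             \<le> C z * (norm (\<theta> - \<theta>P) + norm (\<eta> - \<eta>P)) * norm h * norm v \<and>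
           \<bar>d2_theta (\<lambda>t. l t \<eta>) \<theta> z h u - d2_theta (\<lambda>t. l t \<eta>P) \<theta>P z h u\<bar>
             \<le> C z * (norm (\<theta> - \<theta>P) + norm (\<eta> - \<eta>P)) * norm h * norm u"
    if "z \<in> space P" "\<theta> \<in> ball \<theta>P r" "\<eta> \<in> ball \<eta>P r" for z \<theta> \<eta> h u v
    using bds[rule_format, OF mem mem mem' mem', OF that(2) centre(1) that(3) centre(2) that(1)] .
  have "enveloped_loss P l m \<theta>P \<eta>P C r"
  proof (unfold_locales, goal_cases)
    case 1 show ?case by (rule r)
  next
    case 2 show ?case by (rule l_meas)
  next
    case 3 show ?case by (rule m_meas)
  next
    case (4 z) then show ?case by (rule C(2))
  next
    case 5 show ?case by (rule C_int)
  next
    case (6 z \<eta>)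
    then have "twice_frechet_differentiable_on (\<lambda>\<theta>. l \<theta> \<eta> z) (ball \<theta>P r0)"
      by (intro r0(2)) (auto simp: r_def)
    then show ?case
      unfolding twice_frechet_differentiable_on_def by (elim ex_forward) (simp add: r_def)
  next
    case (7 z \<theta>) then show ?case by (intro r0(3)) (auto simp: r_def)
  next
    case 8 show ?case using reg unfolding regularity_def by blast
  next
    case 9 show ?case using reg unfolding regularity_def by blast
  next
    case 10 then show ?case using bds' by blast
  next
    case (11 z \<theta>) then show ?case using bds'[OF _ _ centre(2)] by blast
  next
    case (12 z h) then show ?case using bds'[OF _ centre] by blast
  next
    case (13 z \<theta> h) then show ?case using bds'[OF _ _ centre(2)] by blast
  next
    case (14 z h) then show ?case using bds'[OF _ centre] by blast
  next
    case (15 z h u) then show ?case using bds'[OF _ centre] by blast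
  next
    case (16 z \<theta> h u)
    \<comment> \<open>With both nuisances equal to \<eta>P their distance drops out, which leaves a
      bound in \<theta> alone.\<close>
    then have "\<bar>d2_theta (\<lambda>t. l t \<eta>P) \<theta> z h u - d2_theta (\<lambda>t. l t \<eta>P) \<theta>P z h u\<bar>
             \<le> C z * (norm (\<theta> - \<theta>P) + norm (\<eta>P - \<eta>P)) * norm h * norm u"
      using bds'[OF _ _ centre(2)] by blast
    then show ?case by simp
  next
    case (17 z h v) then show ?case using bds'[OF _ centre] by blast
  next
    case (18 z \<theta> \<eta> h v) then show ?case using bds' by blast
  qed
  then show ?thesis by (rule that)
qed

text \<open>If \<open>\<alpha>P = 0\<close>, then \<open>\<alpha> = 0\<close> is admissible in every
  neighbourhood and makes the right-hand side vanish, while a nonlinear \<open>m\<close> can still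
  change \<Psi> to second order; \<open>nondegenerate\<close> excludes this conflict.
  \<open>K\<close> and \<open>U\<close> are chosen before the parameters, so the constant is
  uniform, and closeness to \<alpha>P is measured in the completed norm.\<close>

theorem theorem1:
  fixes MC :: "'c measure" and MA :: "'d measure"
    and PC :: "'c measure" and Pi_e :: "'c \<Rightarrow> 'd measure" and PY :: "'c \<times> 'd \<Rightarrow> real measure"
    and P :: "('c \<times> 'd \<times> real) measure"
    and l :: "'a::real_normed_vector \<Rightarrow> 'b::real_normed_vector \<Rightarrow> 'c \<times> 'd \<times> real \<Rightarrow> real"
    and m :: "'a \<Rightarrow> 'c \<times> 'd \<times> real \<Rightarrow> real"
    and \<theta>P :: 'a and \<eta>P :: 'b
    and j :: "'a \<Rightarrow> 'e::banach" and \<alpha>P :: 'e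
  defines "P \<equiv> eval_law MC MA PC Pi_e PY"
  assumes PC: "PC \<in> space (prob_algebra MC)"
    and Pi_e: "Pi_e \<in> MC \<rightarrow>\<^sub>M prob_algebra MA"
    and PY: "PY \<in> MC \<Otimes>\<^sub>M MA \<rightarrow>\<^sub>M prob_algebra borel"
    and l_meas: "\<And>\<theta> \<eta>. l \<theta> \<eta> \<in> borel_measurable (MC \<Otimes>\<^sub>M MA \<Otimes>\<^sub>M borel)"
    and m_meas: "(\<lambda>(\<theta>, z). m \<theta> z) \<in> borel_measurable (borel \<Otimes>\<^sub>M (MC \<Otimes>\<^sub>M MA \<Otimes>\<^sub>M borel))"
    and reg: "regularity P l m \<theta>P \<eta>P"
    and env: "envelope P l m \<theta>P \<eta>P"
    and compl: "is_completion (\<lambda>h. sqrt (hess P l \<theta>P \<eta>P h h)) j"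
    and riesz: "is_riesz_representer P l m \<theta>P \<eta>P j \<alpha>P"
    and nondegenerate: "\<delta>_lin P m \<theta>P = 1 \<Longrightarrow> \<alpha>P \<noteq> 0"
  shows "\<exists>K U. open U \<and> (\<theta>P, \<eta>P, \<alpha>P) \<in> U \<and>
    (\<forall>\<theta> \<eta> \<alpha>. (\<theta>, \<eta>, j \<alpha>) \<in> U \<longrightarrow>
      (\<exists>R1 R2. \<bar>R1\<bar> \<le> K * (norm \<alpha> * (norm (\<theta> - \<theta>P))\<^sup>2) \<and>
        \<bar>R2\<bar> \<le> K * (norm \<alpha> * (norm (\<theta> - \<theta>P) * norm (\<eta> - \<eta>P) + (norm (\<eta> - \<eta>P))\<^sup>2)) \<and>
        \<Psi> P m \<theta> - \<Psi> P m \<theta>P =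
          (\<integral>z. d_theta (\<lambda>t. l t \<eta>) \<theta> z \<alpha> \<partial>P)
          - extend_form j (hess P l \<theta>P \<eta>P) (j \<alpha> - \<alpha>P) (j (\<theta> - \<theta>P))
          + (\<delta>_lin P m \<theta>P + \<delta>_quad P l \<theta>P \<eta>P) * R1 + R2))"
proof -
  let ?N = "MC \<Otimes>\<^sub>M MA \<Otimes>\<^sub>M (borel :: real measure)"
  have P_in: "P \<in> space (prob_algebra ?N)"
    unfolding P_def by (rule eval_law_in_prob_algebra[OF PC Pi_e PY])
  then have P: "prob_space P" and sets_P: "sets P = sets ?N"
    by (auto simp: space_prob_algebra)
  have l_meas': "l \<theta> \<eta> \<in> borel_measurable P" for \<theta> \<eta>
    using l_meas by (simp cong: measurable_cong_sets add: sets_P)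
  have "m \<theta> \<in> borel_measurable ?N" for \<theta>
    using measurable_compose[OF measurable_Pair1' m_meas, of \<theta>] by simp
  then have m_meas': "m \<theta> \<in> borel_measurable P" for \<theta>
    by (simp cong: measurable_cong_sets add: sets_P)
  obtain C r where "enveloped_loss P l m \<theta>P \<eta>P C r"
    using enveloped_lossI[OF P l_meas' m_meas' reg env] .
  then interpret enveloped_loss P l m \<theta>P \<eta>P C r .

  have j: "linear j" "closure (range j) = UNIV" and norm_j: "norm (j h) = sqrt (H h h)" for h
    using compl by (auto simp: is_completion_def)
  from reg obtain c where c: "c > 0" "\<And>h. c * (norm h)\<^sup>2 \<le> H h h"
    unfolding regularity_def by blast
  \<comment> \<open>Coercivity and \<open>hess_le\<close> make the two norms equivalent. The lower
    estimate bounds \<open>H\<close> in the completed norm; the upper one later keeps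
    \<open>norm \<alpha>\<close> away from 0.\<close>
  have norm_le_j: "sqrt c * norm h \<le> norm (j h)" for h
    using real_sqrt_le_mono[OF c(2)[of h]] by (simp add: norm_j real_sqrt_mult)
  have j_le_norm: "norm (j h) \<le> sqrt M * norm h" for h
  proof -
    have "H h h \<le> M * (norm h)\<^sup>2" using hess_le[of h h] by (simp add: power2_eq_square mult.assoc)
    from real_sqrt_le_mono[OF this] show ?thesis by (simp add: norm_j real_sqrt_mult)
  qed
  have hess_le_j: "\<bar>H u h\<bar> \<le> M / c * norm (j u) * norm (j h)" for u h
  proof -
    have "(sqrt c * norm u) * (sqrt c * norm h) \<le> norm (j u) * norm (j h)"
      using c(1) by (intro mult_mono norm_le_j) auto
    also have "(sqrt c * norm u) * (sqrt c * norm h) = c * (norm u * norm h)"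
      using c(1) by simp
    finally have "norm u * norm h \<le> norm (j u) * norm (j h) / c"
      using c(1) by (simp add: pos_le_divide_eq mult.commute)
    from mult_left_mono[OF this M_nonneg] show ?thesis
      using hess_le[of u h] by (simp add: mult.assoc)
  qed

  \<comment> \<open>When \<open>m\<close> is not linear at \<theta>P the implication is vacuous and
    radius 1 serves, so \<open>s1\<close> exists in either case; likewise \<open>s2\<close>.\<close>
  obtain s1 where s1: "s1 > 0" "\<And>\<theta>. linear_at (space P) m \<theta>P \<Longrightarrow> \<theta> \<in> ball \<theta>P s1 \<Longrightarrow>
      \<Psi> P m \<theta> - \<Psi> P m \<theta>P = (\<integral>z. d_theta m \<theta>P z (\<theta> - \<theta>P) \<partial>P)"
    using \<Psi>_linear zero_less_one by metis
  obtain s2 where s2: "s2 > 0" "\<And>\<theta> \<alpha>. quadratic_at (space P) (\<lambda>\<theta>. l \<theta> \<eta>P) \<theta>P \<Longrightarrow>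
      \<theta> \<in> ball \<theta>P s2 \<Longrightarrow> (\<integral>z. d_theta (\<lambda>t. l t \<eta>P) \<theta> z \<alpha> \<partial>P) = H \<alpha> (\<theta> - \<theta>P)"
    using score_quadratic zero_less_one by metis
  \<comment> \<open>Within half the length of \<alpha>P, \<open>norm (j \<alpha>)\<close> stays
    above \<open>norm \<alpha>P / 2\<close>. If \<open>\<alpha>P = 0\<close> the radius 1 is
    arbitrary, since \<open>m\<close> is then linear at \<theta>P by
    \<open>nondegenerate\<close>.\<close>
  define \<rho> where "\<rho> = (if \<alpha>P = 0 then 1 else norm \<alpha>P / 2)"
  define U where "U = ball \<theta>P (min r (min s1 s2)) \<times> ball \<eta>P r \<times> ball \<alpha>P \<rho>"
  \<comment> \<open>Since \<open>norm \<alpha>P \<le> 2 * sqrt M * norm \<alpha>\<close> near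
    \<alpha>P, this constant brings the factor \<open>norm \<alpha>\<close> into
    \<open>\<Psi>_remainder\<close>. For \<open>\<alpha>P = 0\<close> division by zero makes it 0,
    which matches \<open>e1 = 0\<close> there.\<close>
  define K1 where "K1 = 2 * M * sqrt M / norm \<alpha>P"
  define \<delta> where "\<delta> = \<delta>_lin P m \<theta>P + \<delta>_quad P l \<theta>P \<eta>P"
  have K1: "0 \<le> K1" using M_nonneg by (simp add: K1_def)
  show ?thesis
  proof (rule exI[of _ "M + K1"], rule exI[of _ U], intro conjI allI impI)
    show "open U" unfolding U_def by (intro open_Times open_ball)
    show "(\<theta>P, \<eta>P, \<alpha>P) \<in> U" using r s1 s2 by (simp add: U_def \<rho>_def)
    fix \<theta> \<eta> \<alpha> assume "(\<theta>, \<eta>, j \<alpha>) \<in> U"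
    then have \<theta>: "\<theta> \<in> ball \<theta>P r" "\<theta> \<in> ball \<theta>P s1" "\<theta> \<in> ball \<theta>P s2"
      and \<eta>: "\<eta> \<in> ball \<eta>P r" and \<alpha>: "dist \<alpha>P (j \<alpha>) < \<rho>"
      by (auto simp: U_def)
    let ?h = "\<theta> - \<theta>P" and ?k = "\<eta> - \<eta>P"
    define e1 where "e1 = \<Psi> P m \<theta> - \<Psi> P m \<theta>P - (\<integral>z. d_theta m \<theta>P z ?h \<partial>P)"
    define e2 where "e2 = (\<integral>z. d_theta (\<lambda>t. l t \<eta>P) \<theta> z \<alpha> \<partial>P) - H \<alpha> ?h"
    define e3 where "e3 = (\<integral>z. d_theta (\<lambda>t. l t \<eta>) \<theta> z \<alpha> \<partial>P) - (\<integral>z. d_theta (\<lambda>t. l t \<eta>P) \<theta> z \<alpha> \<partial>P)"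
    have e1: "\<bar>e1\<bar> \<le> K1 * (norm \<alpha> * (norm ?h)\<^sup>2)"
    proof (cases "linear_at (space P) m \<theta>P")
      case True
      then show ?thesis using s1(2) \<theta>(2) K1 by (simp add: e1_def)
    next
      case False
      then have \<alpha>P: "\<alpha>P \<noteq> 0" using nondegenerate by (simp add: \<delta>_lin_def)
      \<comment> \<open>Near \<open>\<alpha>P \<noteq> 0\<close> the norm of \<open>\<alpha>\<close> is bounded below, so the factor \<open>norm \<alpha>\<close> costs only a constant.\<close>
      have "norm \<alpha>P \<le> norm (j \<alpha>) + dist \<alpha>P (j \<alpha>)"
        using norm_triangle_sub[of \<alpha>P "j \<alpha>"] by (simp add: dist_norm)
      then have "norm \<alpha>P \<le> 2 * sqrt M * norm \<alpha>"
        using \<alpha> \<alpha>P j_le_norm[of \<alpha>] by (simp add: \<rho>_def)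
      then have "1 \<le> 2 * sqrt M * norm \<alpha> / norm \<alpha>P" using \<alpha>P by simp
      from mult_left_mono[OF this, of "M * (norm ?h)\<^sup>2"]
      have "M * (norm ?h)\<^sup>2 \<le> K1 * (norm \<alpha> * (norm ?h)\<^sup>2)"
        using M_nonneg by (simp add: K1_def mult_ac)
      with \<Psi>_remainder[OF \<theta>(1)] show ?thesis by (simp add: e1_def)
    qed
    have e2: "\<bar>e2\<bar> \<le> M * (norm \<alpha> * (norm ?h)\<^sup>2)"
      unfolding e2_def by (rule score_remainder(2)[OF \<theta>(1)])
    have e3: "\<bar>e3\<bar> \<le> M * (norm \<alpha> * (norm ?h * norm ?k + (norm ?k)\<^sup>2))"
      unfolding e3_def by (rule nuisance_remainder[OF \<theta>(1) \<eta>])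
    \<comment> \<open>The sum of the indicators is 0, 1 or 2, and 0 only if both expansions are
      exact. So either there is nothing to absorb, or dividing by \<delta> does not enlarge the
      remainder.\<close>
    have \<delta>: "\<delta> = 0 \<and> e1 = 0 \<and> e2 = 0 \<or> 1 \<le> \<delta>"
      using s1(2) s2(2) \<theta> by (auto simp: \<delta>_def \<delta>_lin_def \<delta>_quad_def e1_def e2_def)
    have ext: "extend_form j H (j \<alpha> - \<alpha>P) (j ?h) = H \<alpha> ?h - extend_form j H \<alpha>P (j ?h)"
      by (rule extend_form_diff[OF j bilinear_hess hess_le_j])
    have rr: "(\<integral>z. d_theta m \<theta>P z ?h \<partial>P) = extend_form j H \<alpha>P (j ?h)"
      using riesz by (simp add: is_riesz_representer_def)
    \<comment> \<open>By \<open>rr\<close> and \<open>ext\<close> the leading terms of both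
      expansions combine into the extended form, leaving \<open>e1 - e2 - e3\<close>. The quotient
      by \<delta> cancels the indicator factor; for \<open>\<delta> = 0\<close> its numerator is 0
      too.\<close>
    show "\<exists>R1 R2. \<bar>R1\<bar> \<le> (M + K1) * (norm \<alpha> * (norm ?h)\<^sup>2) \<and>
        \<bar>R2\<bar> \<le> (M + K1) * (norm \<alpha> * (norm ?h * norm ?k + (norm ?k)\<^sup>2)) \<and>
        \<Psi> P m \<theta> - \<Psi> P m \<theta>P =
          (\<integral>z. d_theta (\<lambda>t. l t \<eta>) \<theta> z \<alpha> \<partial>P)
          - extend_form j H (j \<alpha> - \<alpha>P) (j ?h)
          + (\<delta>_lin P m \<theta>P + \<delta>_quad P l \<theta>P \<eta>P) * R1 + R2"
    proof (rule exI[of _ "(e1 - e2) / \<delta>"], rule exI[of _ "- e3"], intro conjI)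
      have "\<bar>(e1 - e2) / \<delta>\<bar> \<le> \<bar>e1 - e2\<bar>"
        using \<delta> divide_left_mono[of 1 \<delta> "\<bar>e1 - e2\<bar>"] by auto
      then show "\<bar>(e1 - e2) / \<delta>\<bar> \<le> (M + K1) * (norm \<alpha> * (norm ?h)\<^sup>2)"
        using e1 e2 by (simp add: distrib_right)
      have "0 \<le> K1 * (norm \<alpha> * (norm ?h * norm ?k + (norm ?k)\<^sup>2))" using K1 by simp
      then show "\<bar>- e3\<bar> \<le> (M + K1) * (norm \<alpha> * (norm ?h * norm ?k + (norm ?k)\<^sup>2))"
        using e3 by (simp add: distrib_right)
      have "(\<delta>_lin P m \<theta>P + \<delta>_quad P l \<theta>P \<eta>P) * ((e1 - e2) / \<delta>) = e1 - e2"
        unfolding \<delta>_def[symmetric] using \<delta> by auto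
      then show "\<Psi> P m \<theta> - \<Psi> P m \<theta>P = (\<integral>z. d_theta (\<lambda>t. l t \<eta>) \<theta> z \<alpha> \<partial>P)
          - extend_form j H (j \<alpha> - \<alpha>P) (j ?h)
          + (\<delta>_lin P m \<theta>P + \<delta>_quad P l \<theta>P \<eta>P) * ((e1 - e2) / \<delta>) + - e3"
        unfolding ext using rr by (simp add: e1_def e2_def e3_def)
    qed
  qed
qed

end
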